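(* Any data structure for dynamic weighted orthogonal range counting in the cell probe model must satisfy $t_q = \Omega\big((\lg n/\lg(w t_u))^2\big)$, where $n$ is the number of update operations, $w$ is the cell size, $t_u$ is the worst case update time and $t_q$ is the expected average query time. This lower bound holds when the weights of the inserted points are $\Theta(\lg n)$-bit integers.
   Context: Dynamic weighted orthogonal range counting (in 2-d): maintain a set of two-dimensional points under insertions, each point carrying an integer weight; a query is a point $q=(x,y)$ and must return the sum of the weights of the stored points $(x',y')$ dominated by $q$, i.e. with $x'\le x$ and $y'\le y$. Cell probe model: memory consists of cells of $w$ bits each, addressed by integers in $[2^w]$, with $w=\Omega(\lg n)$ when analysing $n$ updates. An update (resp. query) reads/writes ("probes") cells, where each probed cell and the final answer may be an arbitrary function of the operation and the contents of previously probed cells; the update time is the number of cells probed during an update (worst case over updates), and the query time is the number of cells probed when answering a query. Expected average query time $t_q$: for any data structure with a possibly randomized query algorithm, there exists a sequence of updates $U$ such that the expected cost of answering a uniformly random query after $U$ is $t_q$. *)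

theory Defs
  imports "HOL-Probability.Probability"
begin

text \<open>Addresses and cell contents are naturals; \<open>fits w\<close> below confines both to \<open>{0..<2 ^ w}\<close>.\<close>

type_synonym memory = "nat \<Rightarrow> nat"

text \<open>
  A cell probe algorithm for one fixed operation. Every continuation is an arbitrary
  function of the contents read so far, so computation between probes is free.
\<close>

datatype 'r cell_prog =
    Return 'r
  | Read nat "nat \<Rightarrow> 'r cell_prog"
  | Write nat nat "'r cell_prog"

primrec fits :: "nat \<Rightarrow> 'r cell_prog \<Rightarrow> bool" where
  "fits w (Return r) \<longleftrightarrow> True"
| "fits w (Read a k) \<longleftrightarrow> a < 2 ^ w \<and> (\<forall>c. c < 2 ^ w \<longrightarrow> fits w (k c))"
| "fits w (Write a c p) \<longleftrightarrow> a < 2 ^ w \<and> c < 2 ^ w \<and> fits w p"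

primrec result :: "'r cell_prog \<Rightarrow> memory \<Rightarrow> 'r" where
  "result (Return r) m = r"
| "result (Read a k) m = result (k (m a)) m"
| "result (Write a c p) m = result p (m(a := c))"

primrec final_memory :: "'r cell_prog \<Rightarrow> memory \<Rightarrow> memory" where
  "final_memory (Return r) m = m"
| "final_memory (Read a k) m = final_memory (k (m a)) m"
| "final_memory (Write a c p) m = final_memory p (m(a := c))"

primrec probed_cells :: "'r cell_prog \<Rightarrow> memory \<Rightarrow> nat set" where
  "probed_cells (Return r) m = {}"
| "probed_cells (Read a k) m = insert a (probed_cells (k (m a)) m)"
| "probed_cells (Write a c p) m = insert a (probed_cells p (m(a := c)))"

type_synonym point = "nat \<times> nat"

text \<open>
  Updates are deterministic and queries are randomized: a query draws its coins up front,
  that is, it draws a deterministic algorithm. Discrete distributions lose no generality, since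
  for fixed \<open>w\<close> there are only countably many algorithms that terminate on all
  memories, up to branches on contents outside \<open>{0..<2 ^ w}\<close>.
\<close>

record range_ds =
  initial :: memory
  insert_prog :: "point \<Rightarrow> nat \<Rightarrow> unit cell_prog"
  query_prog :: "point \<Rightarrow> nat cell_prog pmf"

definition grid :: "nat \<Rightarrow> point set" where
  "grid n = {0..<n} \<times> {0..<n}"

text \<open>
  Sequences of at most \<open>n\<close> insertions of weighted points. The stored points form a set,
  hence no point is inserted twice; the weights are \<open>b\<close>-bit integers.
\<close>

definition insertions :: "nat \<Rightarrow> nat \<Rightarrow> (point \<times> nat) list set" where
  "insertions n b =
     {U. length U \<le> n \<and> distinct (map fst U) \<and> set U \<subseteq> grid n \<times> {0..<2 ^ b}}"

definition memory_after :: "range_ds \<Rightarrow> (point \<times> nat) list \<Rightarrow> memory" where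
  "memory_after D U = fold (\<lambda>(p, v). final_memory (insert_prog D p v)) U (initial D)"

definition range_sum :: "(point \<times> nat) list \<Rightarrow> point \<Rightarrow> nat" where
  "range_sum U q =
     (\<Sum>(p, v)\<leftarrow>U. if fst p \<le> fst q \<and> snd p \<le> snd q then v else 0)"

text \<open>
  Answers have to be correct with probability one. Nothing is required of the memory that a
  query leaves behind.
\<close>

definition is_range_ds :: "nat \<Rightarrow> nat \<Rightarrow> nat \<Rightarrow> range_ds \<Rightarrow> bool" where
  "is_range_ds w n b D \<longleftrightarrow>
     (\<forall>a. initial D a < 2 ^ w) \<and>
     (\<forall>p \<in> grid n. \<forall>v < 2 ^ b. fits w (insert_prog D p v)) \<and>
     (\<forall>q \<in> grid n. \<forall>P \<in> set_pmf (query_prog D q). fits w P \<and>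
        (\<forall>U \<in> insertions n b. result P (memory_after D U) = range_sum U q))"

definition update_time :: "nat \<Rightarrow> nat \<Rightarrow> range_ds \<Rightarrow> nat" where
  "update_time n b D =
     Max {card (probed_cells (insert_prog D p v) (memory_after D U)) | U p v.
            U @ [(p, v)] \<in> insertions n b}"

definition avg_query_cost :: "nat \<Rightarrow> range_ds \<Rightarrow> (point \<times> nat) list \<Rightarrow> real" where
  "avg_query_cost n D U =
     measure_pmf.expectation (pmf_of_set (grid n) \<bind> query_prog D)
       (\<lambda>P. real (card (probed_cells P (memory_after D U))))"

definition query_time :: "nat \<Rightarrow> nat \<Rightarrow> range_ds \<Rightarrow> real" where
  "query_time n b D = Max {avg_query_cost n D U | U. U \<in> insertions n b \<and> length U = n}"

end

theory Submission imports Defs begin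

text \<open>
  Chronogram method. Put $B = (w t_u)^8$. The hard updates come in epochs of sizes
  $B^{e+1}$, for decreasing $e \le E$ with $E$ a small multiple of $\lg n / \lg(w t_u)$; an epoch
  consists of the points of a bit-reversal permutation in base $B$, with random weights. The cells
  last probed in different epochs are disjoint, so it suffices that an average query probes
  $\Omega(E)$ cells of each of the larger epochs.

  Fix one epoch $e$ and put $k = B^e$. A butterfly network with $e$ layers of permutations of $B$
  symbols routes $k$ inputs $v$ to outputs $x$ and so describes $k$ queries $(v, x)$ that are
  spread evenly over each of $e$ grids of different aspect ratios. If queries probe on average at
  most $\tau / 2$ cells of the epoch, then half of all networks probe at most $k \tau$ of them, and
  one set $C'$ of $k \tau$ cells contains the cells probed by a fraction $B^{-O(\tau k)}$ of all
  networks. Networks are products over their switches, so for $\tau \le e / 8$ there have to be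
  $k \sqrt B$ different boxes of one of the grids that are hit by queries answerable from $C'$.
  Each box contains a point of the epoch, which makes $\Omega(k \sqrt B)$ of these queries linearly
  independent as functions of the weights. Their answers carry more bits than it takes to describe
  these queries, the contents of $C'$ and the cells probed by the later, much smaller epochs.
\<close>

section \<open>Words\<close>

text \<open>Why networks: the encoding needs more than k independent queries, because the cells of
  the later epochs alone already cost about k * u addresses and contents, where u is the update
  time. A network makes e * k letter choices for its k queries, each among B letters. Fixing k *
  \<tau> cells in advance costs, up to constants, a factor B^(2 k \<tau>), hence at most B^(1/4) per
  letter when 8 \<tau> \<le> e. If every grid had fewer than k * sqrt B boxes that are hit, then on
  average fewer than sqrt B possibilities per letter would remain. As B^(1/4) * B^(1/2) is well
  below B, such networks cannot make up half of all networks. This comparison with e * k choices is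
  what makes the bound per epoch proportional to e. It also explains the fourth power B =
  \<gamma>^4: the two losses are \<gamma> and \<gamma>^2, and 18 \<gamma>^3 < \<gamma>^4 / 3 as soon
  as \<gamma> > 54.\<close>

definition words :: "nat \<Rightarrow> nat \<Rightarrow> nat list set" where
  "words B l = {xs. set xs \<subseteq> {..<B} \<and> length xs = l}"

lemma finite_words [simp]: "finite (words B l)"
  unfolding words_def by (rule finite_lists_length_eq) simp

lemma card_words [simp]: "card (words B l) = B ^ l"
  unfolding words_def by (subst card_lists_length_eq) simp_all

lemma length_words: "xs \<in> words B l \<Longrightarrow> length xs = l"
  by (simp add: words_def)

lemma nth_words: "xs \<in> words B l \<Longrightarrow> j < l \<Longrightarrow> xs ! j < B"
  unfolding words_def by (metis (mono_tags, lifting) lessThan_iff mem_Collect_eq nth_mem subsetD)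

lemma take_words: "xs \<in> words B l \<Longrightarrow> j \<le> l \<Longrightarrow> take j xs \<in> words B j"
  unfolding words_def by (auto dest: in_set_takeD)

lemma drop_words: "xs \<in> words B l \<Longrightarrow> drop j xs \<in> words B (l - j)"
  unfolding words_def by (auto dest: in_set_dropD)

lemma Cons_words_iff [simp]: "x # xs \<in> words B (Suc l) \<longleftrightarrow> x < B \<and> xs \<in> words B l"
  unfolding words_def by auto

lemma append_words: "xs \<in> words B l \<Longrightarrow> ys \<in> words B l' \<Longrightarrow> xs @ ys \<in> words B (l + l')"
  unfolding words_def by auto

lemma rev_words [simp]: "rev xs \<in> words B l \<longleftrightarrow> xs \<in> words B l"
  unfolding words_def by auto

section \<open>Butterfly networks\<close>

type_synonym network = "nat list \<times> nat list \<Rightarrow> nat \<Rightarrow> nat"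

text \<open>Layer j replaces letter j of a state. The switch it uses depends on all other letters: p
  holds those already replaced, c those still to come.\<close>

primrec route :: "network \<Rightarrow> nat list \<Rightarrow> nat list \<Rightarrow> nat list" where
  "route \<phi> p [] = []"
| "route \<phi> p (d # c) = \<phi> (p, c) d # route \<phi> (p @ [\<phi> (p, c) d]) c"

text \<open>The e - 1 idle letters of a state name the switch, so each of the e layers consists of
  B^(e - 1) switches on B symbols.\<close>

definition contexts :: "nat \<Rightarrow> nat \<Rightarrow> (nat list \<times> nat list) set" where
  "contexts B e = (\<Union>j<e. words B j \<times> words B (e - Suc j))"

text \<open>Extensionality makes this a finite product, so the switches of a uniformly random
  network are independent.\<close>

definition networks :: "nat \<Rightarrow> nat \<Rightarrow> network set" where
  "networks B e = (\<Pi>\<^sub>E pc \<in> contexts B e. {\<pi>. \<pi> permutes {..<B}})"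

text \<open>
  A query is a pair of words: $x$ is its x-coordinate and $v$ its y-coordinate read backwards.
  Hence the last $e - j$ letters of $v$ are the leading digits of the y-coordinate, and an element
  of \<open>hits j Q\<close> is a box of the $j$-th grid. It also is the state of a network before layer $j$
  together with the new letter chosen by that layer.
\<close>

definition hits :: "nat \<Rightarrow> (nat list \<times> nat list) set \<Rightarrow> (nat list \<times> nat list) set" where
  "hits j Q = (\<lambda>(v, x). (take (Suc j) x, drop j v)) ` Q"

lemma finite_contexts [simp]: "finite (contexts B e)"
  unfolding contexts_def by auto

lemma sum_contexts:
  "(\<Sum>pc\<in>contexts B e. f pc) = (\<Sum>j<e. \<Sum>pc \<in> words B j \<times> words B (e - Suc j). f pc)"
  unfolding contexts_def
  by (rule sum.UNION_disjoint) (auto dest!: length_words)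

lemma card_contexts: "card (contexts B e) * B = e * B ^ e"
proof -
  have "card (contexts B e) = (\<Sum>j<e. card (words B j \<times> words B (e - Suc j)))"
    using sum_contexts[of "\<lambda>_. 1::nat" B e] by simp
  also have "\<dots> = (\<Sum>j<e. B ^ (e - 1))"
    by (rule sum.cong) (auto simp: card_cartesian_product simp flip: power_add)
  finally show ?thesis by (cases e) (auto simp: algebra_simps)
qed

lemma card_perms: "card {\<pi>. \<pi> permutes {..<B}} = fact B"
  using card_permutations[of "{..<B}" B] by simp

lemma finite_networks [simp]: "finite (networks B e)"
  unfolding networks_def by (intro finite_PiE) (auto intro: finite_permutations)

lemma card_networks: "card (networks B e) = fact B ^ card (contexts B e)"
  unfolding networks_def by (simp add: card_PiE card_perms)

lemma network_permutes:
  "\<phi> \<in> networks B e \<Longrightarrow> pc \<in> contexts B e \<Longrightarrow> \<phi> pc permutes {..<B}"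
  unfolding networks_def by auto

lemma contextI: "p \<in> words B j \<Longrightarrow> c \<in> words B l \<Longrightarrow> e = Suc (j + l) \<Longrightarrow> (p, c) \<in> contexts B e"
  unfolding contexts_def by auto

lemma route_words:
  assumes "\<phi> \<in> networks B e" "p \<in> words B j" "v \<in> words B l" "j + l = e"
  shows "route \<phi> p v \<in> words B l"
  using assms(2-)
proof (induction v arbitrary: p j l)
  case Nil
  then show ?case by (auto simp: words_def)
next
  case (Cons d c)
  then obtain l' where l': "l = Suc l'" by (auto simp: words_def)
  with Cons.prems have d: "d < B" "c \<in> words B l'" by auto
  have pc: "(p, c) \<in> contexts B e"
    using Cons.prems d l' by (intro contextI[of p B j c l']) auto
  have x: "\<phi> (p, c) d < B"
    using permutes_in_image[OF network_permutes[OF assms(1) pc]] d by simp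
  have "p @ [\<phi> (p, c) d] \<in> words B (Suc j)"
    using Cons.prems(1) x by (auto simp: words_def)
  from Cons.IH[OF this d(2)] Cons.prems l' x show ?case by simp
qed

text \<open>Once the output x is prescribed, all states on the way are known in advance. The
  recursion then dissolves into one condition on each switch of a path, which is what makes routes
  countable by a product.\<close>

lemma route_eq_iff:
  "route \<phi> p v = x \<longleftrightarrow> length x = length v \<and>
     (\<forall>j<length v. \<phi> (p @ take j x, drop (Suc j) v) (v ! j) = x ! j)"
proof (induction v arbitrary: p x)
  case (Cons d c)
  show ?case
  proof (cases x)
    case (Cons y ys)
    show ?thesis
      unfolding Cons by (auto simp: Cons.IH All_less_Suc2)
  qed simp
qed auto

text \<open>Layers can be run backwards because switches are bijections: the last letter of p is
  pulled back through its switch to the letter that the switch has read.\<close>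

lemma reachable:
  assumes "\<phi> \<in> networks B e" "p \<in> words B j" "r \<in> words B (e - j)" "j \<le> e"
  shows "\<exists>v \<in> words B e. drop j v = r \<and> route \<phi> [] v = p @ route \<phi> p r"
  using assms(2-)
proof (induction p arbitrary: j r rule: rev_induct)
  case Nil
  then show ?case by (auto simp: words_def)
next
  case (snoc x p)
  then obtain j' where j': "j = Suc j'" by (auto simp: words_def)
  have p: "p \<in> words B j'" "x < B" using snoc.prems j' by (auto simp: words_def)
  have pc: "(p, r) \<in> contexts B e"
    using snoc.prems p j' by (intro contextI[of p B j' r "e - j"]) auto
  note perm = network_permutes[OF assms(1) pc]
  define d where "d = inv (\<phi> (p, r)) x"
  have d: "d < B" "\<phi> (p, r) d = x"
    using p permutes_in_image[OF permutes_inv[OF perm]] permutes_inverses[OF perm]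
    by (auto simp: d_def)
  have "d # r \<in> words B (e - j')" using snoc.prems d j' Cons_words_iff[of d r B "e - Suc j'"]
    by (simp add: Suc_diff_Suc)
  from snoc.IH[OF p(1) this] snoc.prems j' obtain v where
    v: "v \<in> words B e" "drop j' v = d # r" "route \<phi> [] v = p @ route \<phi> p (d # r)" by auto
  have "drop j v = r" unfolding j' using v(2) by (metis drop_Suc list.sel(3) tl_drop)
  with v d show ?case by auto
qed

section \<open>Uniformity of the routed output\<close>

lemma card_perms_fixed:
  assumes "a < B" "b < B" "a' < B" "b' < B"
  shows "card {\<pi>. \<pi> permutes {..<B} \<and> \<pi> a = b} = card {\<pi>. \<pi> permutes {..<B} \<and> \<pi> a' = b'}"
proof (rule bij_betw_same_card)
  \<comment> \<open>Composing with one transposition on each side is an involution, hence its own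
    inverse, and it carries either condition into the other.\<close>
  show "bij_betw (\<lambda>\<pi>. Transposition.transpose b b' \<circ> \<pi> \<circ> Transposition.transpose a a')
     {\<pi>. \<pi> permutes {..<B} \<and> \<pi> a = b} {\<pi>. \<pi> permutes {..<B} \<and> \<pi> a' = b'}"
    by (rule bij_betw_byWitness[where f' = "\<lambda>\<pi>. Transposition.transpose b b' \<circ> \<pi> \<circ> Transposition.transpose a a'"])
       (use assms in \<open>auto simp: fun_eq_iff intro!: permutes_compose permutes_swap_id\<close>)
qed

text \<open>The path from v to x meets e different switches and fixes one entry of each. The number
  of networks that comply is a product independent of x, and the outputs x partition all networks,
  so each x receives a fraction B^(-e).\<close>

lemma card_route_eq:
  assumes v: "v \<in> words B e" and x: "x \<in> words B e"
  shows "card {\<phi> \<in> networks B e. route \<phi> [] v = x} * B ^ e = card (networks B e)"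
proof -
  define q where "q = card {\<pi>. \<pi> permutes {..<B} \<and> \<pi> 0 = 0}"
  define N where "N = q ^ e * fact B ^ (card (contexts B e) - e)"
  have count: "card {\<phi> \<in> networks B e. route \<phi> [] v = x} = N" if x: "x \<in> words B e" for x
  proof -
    define path where "path = (\<lambda>j. (take j x, drop (Suc j) v)) ` {..<e}"
    have path: "path \<subseteq> contexts B e"
      using v x unfolding path_def
      by (auto intro!: contextI take_words drop_words simp: length_words)
    \<comment> \<open>Switches of different layers have prefixes of different lengths.\<close>
    have inj: "inj_on (\<lambda>j. (take j x, drop (Suc j) v)) {..<e}"
      using length_words[OF x] by (auto intro!: inj_onI dest!: arg_cong[of "take _ x" _ length])
    have cpath: "card path = e" unfolding path_def using inj by (simp add: card_image)
    define F where "F pc = (if pc \<in> path then {\<pi>. \<pi> permutes {..<B} \<and>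
        \<pi> (v ! length (fst pc)) = x ! length (fst pc)} else {\<pi>. \<pi> permutes {..<B}})"
      for pc :: "nat list \<times> nat list"
    have "{\<phi> \<in> networks B e. route \<phi> [] v = x} = (\<Pi>\<^sub>E pc \<in> contexts B e. F pc)"
    proof (intro set_eqI iffI)
      fix \<phi> assume "\<phi> \<in> {\<phi> \<in> networks B e. route \<phi> [] v = x}"
      then show "\<phi> \<in> (\<Pi>\<^sub>E pc \<in> contexts B e. F pc)"
        using length_words[OF x] length_words[OF v]
        by (auto simp: route_eq_iff networks_def F_def path_def PiE_iff min_absorb2)
    next
      fix \<phi> assume *: "\<phi> \<in> (\<Pi>\<^sub>E pc \<in> contexts B e. F pc)"
      have "\<phi> \<in> networks B e"
        using * unfolding networks_def F_def PiE_iff by (auto split: if_splits)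
      moreover have "\<phi> (take j x, drop (Suc j) v) (v ! j) = x ! j" if "j < e" for j
      proof -
        have "(take j x, drop (Suc j) v) \<in> path" using that by (auto simp: path_def)
        moreover from this path * have "\<phi> (take j x, drop (Suc j) v) \<in> F (take j x, drop (Suc j) v)"
          by (meson PiE_mem subsetD)
        ultimately show ?thesis using that length_words[OF x] by (simp add: F_def min_absorb2)
      qed
      ultimately show "\<phi> \<in> {\<phi> \<in> networks B e. route \<phi> [] v = x}"
        using length_words[OF x] length_words[OF v] by (auto simp: route_eq_iff)
    qed
    then have "card {\<phi> \<in> networks B e. route \<phi> [] v = x} = (\<Prod>pc\<in>contexts B e. card (F pc))"
      by (simp add: card_PiE)
    also have "\<dots> = (\<Prod>pc\<in>contexts B e. if pc \<in> path then q else fact B)"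
    proof (rule prod.cong[OF refl])
      fix pc assume "pc \<in> contexts B e"
      show "card (F pc) = (if pc \<in> path then q else fact B)"
      proof (cases "pc \<in> path")
        case True
        then obtain j where j: "j < e" "pc = (take j x, drop (Suc j) v)" by (auto simp: path_def)
        have "v ! j < B" "x ! j < B" using nth_words v x j by auto
        then show ?thesis
          using True j length_words[OF x] card_perms_fixed[of "v ! j" B "x ! j" 0 0]
          by (simp add: F_def q_def min_absorb2)
      qed (simp add: F_def card_perms)
    qed
    also have "\<dots> = N"
      using path cpath by (simp add: prod.If_cases Int_absorb1 N_def flip: Diff_eq card_Diff_subset)
        (metis card_Diff_subset finite_contexts infinite_super)
    finally show ?thesis .
  qed
  have "card (networks B e) = (\<Sum>x\<in>words B e. card {\<phi> \<in> networks B e. route \<phi> [] v = x})"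
  proof -
    have "networks B e = (\<Union>x\<in>words B e. {\<phi> \<in> networks B e. route \<phi> [] v = x})"
      using route_words[of _ B e "[]" 0 v e] v by (auto simp: words_def)
    then have "card (networks B e) = card (\<Union>x\<in>words B e. {\<phi> \<in> networks B e. route \<phi> [] v = x})"
      by simp
    also have "\<dots> = (\<Sum>x\<in>words B e. card {\<phi> \<in> networks B e. route \<phi> [] v = x})"
      by (rule card_UN_disjoint) auto
    finally show ?thesis .
  qed
  also have "\<dots> = (\<Sum>x\<in>words B e. N)" using count by simp
  finally show ?thesis using count[OF x] by simp
qed

text \<open>For fixed v the output of a random network is uniform. Linearity of expectation then
  copes with the dependence between different v when the costs of all k queries of a network are
  added.\<close>

lemma sum_route:
  fixes g :: "nat list \<Rightarrow> real"
  assumes v: "v \<in> words B e"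
  shows "(\<Sum>\<phi>\<in>networks B e. g (route \<phi> [] v)) * real (B ^ e) = real (card (networks B e)) * (\<Sum>x\<in>words B e. g x)"
proof -
  have "(\<Sum>\<phi>\<in>networks B e. g (route \<phi> [] v)) =
      (\<Sum>x\<in>words B e. \<Sum>\<phi>\<in>{\<phi> \<in> networks B e. route \<phi> [] v = x}. g (route \<phi> [] v))"
    using route_words[of _ B e "[]" 0 v e] v
    by (intro sum.group[symmetric] finite_networks finite_words) (auto simp: words_def)
  also have "\<dots> = (\<Sum>x\<in>words B e. real (card {\<phi> \<in> networks B e. route \<phi> [] v = x}) * g x)"
    by (intro sum.cong) auto
  finally have "(\<Sum>\<phi>\<in>networks B e. g (route \<phi> [] v)) * real (B ^ e) =
      (\<Sum>x\<in>words B e. real (card {\<phi> \<in> networks B e. route \<phi> [] v = x} * B ^ e) * g x)"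
    by (simp add: sum_distrib_right sum_distrib_left mult_ac)
  also have "\<dots> = (\<Sum>x\<in>words B e. real (card (networks B e)) * g x)"
    by (intro sum.cong refl) (simp only: card_route_eq[OF v])
  finally show ?thesis by (simp add: sum_distrib_left)
qed

text \<open>By \<open>reachable\<close> every entry of every switch is used by some input. So Q sees
  the whole network, and each entry appears as a box of the layer.\<close>

lemma hits_route:
  assumes \<phi>: "\<phi> \<in> networks B e" and Q: "\<And>v. v \<in> words B e \<Longrightarrow> (v, route \<phi> [] v) \<in> Q"
    and p: "p \<in> words B j" and c: "c \<in> words B (e - Suc j)" and j: "j < e" and d: "d < B"
  shows "(p @ [\<phi> (p, c) d], d # c) \<in> hits j Q"
proof -
  have "d # c \<in> words B (e - j)"
    using c d j Cons_words_iff[of d c B "e - Suc j"] by (simp add: Suc_diff_Suc)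
  from reachable[OF \<phi> p this] j obtain v where
    v: "v \<in> words B e" "drop j v = d # c" "route \<phi> [] v = p @ route \<phi> p (d # c)" by auto
  then have "take (Suc j) (route \<phi> [] v) = p @ [\<phi> (p, c) d]"
    using length_words[OF p] by simp
  then show ?thesis unfolding hits_def using Q[OF v(1)] v(2) by (force intro!: image_eqI)
qed

text \<open>A permanent is at most the product of its row sums, since forgetting injectivity turns
  permutations into choice functions. The exponential form involves only the total of the row sums,
  which is what the hits of a layer control.\<close>

lemma card_perms_restricted_le:
  fixes \<beta> :: real
  assumes "\<beta> > 0"
  shows "real (card {\<pi>. \<pi> permutes {..<B} \<and> (\<forall>d<B. \<pi> d \<in> A d)})
    \<le> \<beta> ^ B * exp ((\<Sum>d<B. real (card {x \<in> A d. x < B})) / \<beta>)"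
proof -
  let ?S = "{\<pi>. \<pi> permutes {..<B} \<and> (\<forall>d<B. \<pi> d \<in> A d)}"
  have "inj_on (\<lambda>\<pi>. restrict \<pi> {..<B}) ?S"
  proof (rule inj_onI)
    fix \<pi> \<pi>' assume *: "\<pi> \<in> ?S" "\<pi>' \<in> ?S" "restrict \<pi> {..<B} = restrict \<pi>' {..<B}"
    have "\<pi> d = \<pi>' d" for d
    proof (cases "d < B")
      case True
      then show ?thesis using fun_cong[OF *(3), of d] by simp
    next
      case False
      with * have "\<pi> d = d" "\<pi>' d = d" by (auto intro!: permutes_not_in[of _ "{..<B}"])
      then show ?thesis by simp
    qed
    then show "\<pi> = \<pi>'" by auto
  qed
  moreover have "(\<lambda>\<pi>. restrict \<pi> {..<B}) ` ?S \<subseteq> (\<Pi>\<^sub>E d\<in>{..<B}. {x \<in> A d. x < B})"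
  proof (intro image_subsetI PiE_I)
    fix \<pi> d assume "\<pi> \<in> ?S" "d \<in> {..<B}"
    then show "restrict \<pi> {..<B} d \<in> {x \<in> A d. x < B}"
      using permutes_in_image[of \<pi> "{..<B}" d] by simp
  qed simp
  ultimately have "card ?S \<le> card (\<Pi>\<^sub>E d\<in>{..<B}. {x \<in> A d. x < B})"
    by (intro card_inj_on_le finite_PiE) auto
  also have "\<dots> = (\<Prod>d<B. card {x \<in> A d. x < B})" by (simp add: card_PiE)
  finally have "real (card ?S) \<le> (\<Prod>d<B. real (card {x \<in> A d. x < B}))"
    by (simp only: of_nat_le_iff flip: of_nat_prod)
  txt \<open>The bound $t \le \beta e^{t / \beta}$ on each factor replaces the inequality between means.\<close>
  also have "\<dots> \<le> (\<Prod>d<B. \<beta> * exp (real (card {x \<in> A d. x < B}) / \<beta>))"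
  proof (intro prod_mono conjI)
    fix d
    have "real (card {x \<in> A d. x < B}) / \<beta> \<le> exp (real (card {x \<in> A d. x < B}) / \<beta>)"
      using exp_ge_add_one_self[of "real (card {x \<in> A d. x < B}) / \<beta>"] by linarith
    then show "real (card {x \<in> A d. x < B}) \<le> \<beta> * exp (real (card {x \<in> A d. x < B}) / \<beta>)"
      using assms by (simp add: field_simps)
  qed simp
  also have "\<dots> = \<beta> ^ B * exp ((\<Sum>d<B. real (card {x \<in> A d. x < B})) / \<beta>)"
    by (simp add: prod.distrib exp_sum[symmetric] sum_divide_distrib)
  finally show ?thesis .
qed

text \<open>A box determines the switch (p, c), the letter d read and the letter x written, so no
  box is charged to two entries.\<close>

lemma sum_card_fibres_le:
  assumes "finite H"
  shows "(\<Sum>pc\<in>words B j \<times> words B l. \<Sum>d<B. card {x. (fst pc @ [x], d # snd pc) \<in> H \<and> x < B}) \<le> card H"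
proof -
  let ?F = "\<lambda>(pc, d). {x. (fst pc @ [x], d # snd pc) \<in> H \<and> x < B}"
  have "(\<Sum>pc\<in>words B j \<times> words B l. \<Sum>d<B. card {x. (fst pc @ [x], d # snd pc) \<in> H \<and> x < B}) =
      (\<Sum>t\<in>(words B j \<times> words B l) \<times> {..<B}. card (?F t))"
    by (simp add: sum.cartesian_product split_def)
  also have "\<dots> = card (Sigma ((words B j \<times> words B l) \<times> {..<B}) ?F)"
    by (subst card_SigmaI) auto
  also have "\<dots> \<le> card H"
    by (rule card_inj_on_le[where f = "\<lambda>((pc, d), x). (fst pc @ [x], d # snd pc)"])
       (auto simp: inj_on_def assms)
  finally show ?thesis .
qed

text \<open>By \<open>hits_route\<close> each switch may only use entries whose boxes are hits.
  Keeping just this condition leaves a product over the switches, and the exponents from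
  \<open>card_perms_restricted_le\<close> add up to at most the number of hits. The parameter
  \<beta> plays the part of the average number of letters allowed per entry.\<close>

lemma card_networks_within_le:
  fixes \<beta> :: real
  assumes \<beta>: "\<beta> > 0" and fin: "finite Q"
  shows "real (card {\<phi> \<in> networks B e. \<forall>v \<in> words B e. (v, route \<phi> [] v) \<in> Q})
    \<le> \<beta> ^ (e * B ^ e) * exp ((\<Sum>j<e. real (card (hits j Q))) / \<beta>)"
proof -
  \<comment> \<open>The layer of a switch is recovered from the length of its prefix.\<close>
  define A where "A pc d = {x. (fst pc @ [x], d # snd pc) \<in> hits (length (fst pc)) Q}"
    for pc :: "nat list \<times> nat list" and d
  define G where "G pc = {\<pi>. \<pi> permutes {..<B} \<and> (\<forall>d<B. \<pi> d \<in> A pc d)}" for pc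
  have finG: "finite (G pc)" for pc
    unfolding G_def by (rule finite_subset[OF _ finite_permutations[of "{..<B}"]]) auto
  have "{\<phi> \<in> networks B e. \<forall>v \<in> words B e. (v, route \<phi> [] v) \<in> Q} \<subseteq> (\<Pi>\<^sub>E pc\<in>contexts B e. G pc)"
  proof
    fix \<phi> assume *: "\<phi> \<in> {\<phi> \<in> networks B e. \<forall>v \<in> words B e. (v, route \<phi> [] v) \<in> Q}"
    have "\<phi> pc \<in> G pc" if "pc \<in> contexts B e" for pc
    proof -
      from that obtain p c j where pc: "pc = (p, c)" "p \<in> words B j" "c \<in> words B (e - Suc j)" "j < e"
        unfolding contexts_def by auto
      show ?thesis
        using * hits_route[of \<phi> B e Q p j c] pc network_permutes[OF _ that, of \<phi>] length_words[OF pc(2)]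
        by (auto simp: G_def A_def)
    qed
    with * show "\<phi> \<in> (\<Pi>\<^sub>E pc\<in>contexts B e. G pc)" by (auto simp: networks_def PiE_iff)
  qed
  then have "card {\<phi> \<in> networks B e. \<forall>v \<in> words B e. (v, route \<phi> [] v) \<in> Q} \<le> card (\<Pi>\<^sub>E pc\<in>contexts B e. G pc)"
    by (intro card_mono finite_PiE) (auto simp: finG)
  then have "real (card {\<phi> \<in> networks B e. \<forall>v \<in> words B e. (v, route \<phi> [] v) \<in> Q}) \<le> (\<Prod>pc\<in>contexts B e. real (card (G pc)))"
    by (simp add: card_PiE flip: of_nat_prod)
  also have "\<dots> \<le> (\<Prod>pc\<in>contexts B e. \<beta> ^ B * exp ((\<Sum>d<B. real (card {x \<in> A pc d. x < B})) / \<beta>))"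
    unfolding G_def by (intro prod_mono conjI card_perms_restricted_le \<beta>) auto
  also have "\<dots> = \<beta> ^ (e * B ^ e) * exp ((\<Sum>pc\<in>contexts B e. \<Sum>d<B. real (card {x \<in> A pc d. x < B})) / \<beta>)"
    by (simp add: prod.distrib exp_sum[symmetric] sum_divide_distrib flip: power_mult card_contexts)
      (simp add: mult.commute)
  also have "\<dots> \<le> \<beta> ^ (e * B ^ e) * exp ((\<Sum>j<e. real (card (hits j Q))) / \<beta>)"
  proof -
    have "(\<Sum>pc\<in>contexts B e. \<Sum>d<B. card {x \<in> A pc d. x < B}) =
       (\<Sum>j<e. \<Sum>pc\<in>words B j \<times> words B (e - Suc j). \<Sum>d<B. card {x \<in> A pc d. x < B})"
      by (rule sum_contexts)
    also have "\<dots> = (\<Sum>j<e. \<Sum>pc\<in>words B j \<times> words B (e - Suc j). \<Sum>d<B.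
         card {x. (fst pc @ [x], d # snd pc) \<in> hits j Q \<and> x < B})"
      by (intro sum.cong refl) (auto simp: A_def dest!: length_words)
    also have "\<dots> \<le> (\<Sum>j<e. card (hits j Q))"
      by (intro sum_mono sum_card_fibres_le) (simp add: hits_def fin)
    finally have "(\<Sum>pc\<in>contexts B e. \<Sum>d<B. real (card {x \<in> A pc d. x < B})) \<le> (\<Sum>j<e. real (card (hits j Q)))"
      by (simp flip: of_nat_sum)
    then show ?thesis using \<beta> by (simp add: divide_right_mono)
  qed
  finally show ?thesis .
qed

section \<open>Cell sampling over networks\<close>

lemma card_small_subsets_le:
  fixes y :: real
  assumes "finite C" and y: "y \<ge> 1"
  shows "real (card {A. A \<subseteq> C \<and> card A \<le> s}) \<le> y ^ s * exp (real (card C) / y)"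
proof -
  have "real (card {A. A \<subseteq> C \<and> card A \<le> s}) = (\<Sum>A\<in>{A. A \<subseteq> C \<and> card A \<le> s}. 1)" by simp
  \<comment> \<open>Each counted set A gets the weight y^(s - card A) \<ge> 1. Summed over all
    subsets, these weights are evaluated by the binomial theorem.\<close>
  also have "\<dots> \<le> (\<Sum>A\<in>{A. A \<subseteq> C \<and> card A \<le> s}. y ^ s * (1 / y) ^ card A)"
  proof (intro sum_mono)
    fix A assume "A \<in> {A. A \<subseteq> C \<and> card A \<le> s}"
    then have "y ^ card A \<le> y ^ s" using y by (auto intro: power_increasing)
    then show "1 \<le> y ^ s * (1 / y) ^ card A" using y by (simp add: field_simps)
  qed
  also have "\<dots> \<le> (\<Sum>A\<in>Pow C. y ^ s * (1 / y) ^ card A)"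
    using assms by (intro sum_mono2) auto
  also have "\<dots> = y ^ s * (\<Sum>A\<in>Pow C. (1 / y) ^ card A)" by (simp add: sum_distrib_left)
  also have "(\<Sum>A\<in>Pow C. (1 / y) ^ card A) = (1 / y + 1) ^ card C"
    using prod_add[OF \<open>finite C\<close>, of "\<lambda>_. 1 / y" "\<lambda>_. 1"] by simp
  also have "\<dots> \<le> exp (1 / y) ^ card C"
    using y by (intro power_mono) (auto simp: add.commute exp_ge_add_one_self)
  finally show ?thesis using y by (simp add: mult_left_mono exp_of_nat_mult[symmetric])
qed

text \<open>A single term of the exponential series at B, combined with exp 1 \<le> 3.\<close>

lemma fact_ge_power_third: "(real B / 3) ^ B \<le> fact B"
proof -
  have "real B ^ B / fact B \<le> exp (real B)"
    using exp_lower_Taylor_quadratic[of 0] sum_le_suminf[OF summable_exp_generic[of "real B"], of "{B}"]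
    by (simp add: exp_def field_simps)
  also have "\<dots> \<le> 3 ^ B"
    using power_mono[OF exp_le, of B] by (simp flip: exp_of_nat_mult)
  finally show ?thesis by (simp add: field_simps power_divide)
qed

text \<open>Counting by contradiction: if every small C' leaves few boxes in every layer, then the
  networks of cost at most k \<tau> are covered by too few sets that are too small. Here N = e * k
  counts the pairs of a switch and a letter that it reads, and all quantities are compared as N-th
  powers.\<close>

lemma butterfly_cell_sampling:
  fixes T :: "nat list \<times> nat list \<Rightarrow> nat set" and B \<gamma> \<tau> e u :: nat
  assumes \<gamma>: "\<gamma> > 54" and B: "B = \<gamma> ^ 4" and C: "finite C" "card C \<le> B ^ e * (B * u)" "u \<ge> 1" "u \<le> B"
    and T: "\<And>q. q \<in> words B e \<times> words B e \<Longrightarrow> T q \<subseteq> C"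
    and \<tau>: "1 \<le> \<tau>" "8 * \<tau> \<le> e"
    and avg: "(\<Sum>q\<in>words B e \<times> words B e. real (card (T q))) \<le> real (B ^ e) ^ 2 * real \<tau> / 2"
  shows "\<exists>C' \<subseteq> C. card C' \<le> B ^ e * \<tau> \<and>
    (\<exists>j<e. \<gamma> ^ 2 * B ^ e \<le> card (hits j {q \<in> words B e \<times> words B e. T q \<subseteq> C'}))"
proof (rule ccontr)
  define k where "k = B ^ e"
  define N where "N = e * k"
  define Q where "Q C' = {q \<in> words B e \<times> words B e. T q \<subseteq> C'}" for C'
  define Sub where "Sub = {C'. C' \<subseteq> C \<and> card C' \<le> k * \<tau>}"
  assume "\<not> ?thesis"
  then have few: "card (hits j (Q C')) < \<gamma> ^ 2 * k" if "C' \<in> Sub" "j < e" for C' j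
    using that unfolding Sub_def Q_def k_def by (auto simp: not_le)
  have B1: "B \<ge> 1" and k1: "k \<ge> 1" using \<gamma> B by (auto simp: k_def)
  have e1: "e \<ge> 1" using \<tau> by auto
  have kN: "k \<le> N" "1 \<le> N" using e1 k1 by (auto simp: N_def)
  define cost where "cost \<phi> = (\<Sum>v\<in>words B e. card (T (v, route \<phi> [] v)))" for \<phi>
  define Good where "Good = {\<phi> \<in> networks B e. cost \<phi> \<le> k * \<tau>}"
  define \<Phi> where "\<Phi> = card (networks B e)"
  have in_words: "route \<phi> [] v \<in> words B e" if "\<phi> \<in> networks B e" "v \<in> words B e" for \<phi> v
    using route_words[OF that(1), of "[]" 0 v e] that(2) by (auto simp: words_def)

  \<comment> \<open>Markov's inequality, as the average cost is at most k \<tau> / 2 by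
    \<open>sum_route\<close>.\<close>
  have "real \<Phi> \<le> 2 * real (card Good)"
  proof -
    have "(\<Sum>\<phi>\<in>networks B e. real (cost \<phi>)) * real k =
        (\<Sum>v\<in>words B e. (\<Sum>\<phi>\<in>networks B e. real (card (T (v, route \<phi> [] v)))) * real k)"
      unfolding cost_def of_nat_sum by (subst sum.swap) (simp add: sum_distrib_right)
    also have "\<dots> = (\<Sum>v\<in>words B e. real \<Phi> * (\<Sum>x\<in>words B e. real (card (T (v, x)))))"
      unfolding k_def \<Phi>_def by (intro sum.cong refl sum_route)
    also have "\<dots> = real \<Phi> * (\<Sum>q\<in>words B e \<times> words B e. real (card (T q)))"
      by (simp add: sum.cartesian_product sum_distrib_left)
    also have "\<dots> \<le> real \<Phi> * (real k ^ 2 * real \<tau> / 2)"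
      using avg unfolding k_def by (intro mult_left_mono) auto
    finally have "(\<Sum>\<phi>\<in>networks B e. real (cost \<phi>)) * real k \<le> (real \<Phi> * real k * real \<tau> / 2) * real k"
      by (simp add: power2_eq_square mult_ac)
    then have upper: "(\<Sum>\<phi>\<in>networks B e. real (cost \<phi>)) \<le> real \<Phi> * real k * real \<tau> / 2"
      using k1 by (simp add: mult_ac)
    have "real (card (networks B e - Good)) * (real k * real \<tau>) = (\<Sum>\<phi>\<in>networks B e - Good. real k * real \<tau>)"
      by simp
    also have "\<dots> \<le> (\<Sum>\<phi>\<in>networks B e - Good. real (cost \<phi>))"
      by (intro sum_mono) (auto simp: Good_def simp flip: of_nat_mult)
    also have "\<dots> \<le> (\<Sum>\<phi>\<in>networks B e. real (cost \<phi>))"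
      by (intro sum_mono2) auto
    finally have "real (card (networks B e - Good)) * (real k * real \<tau>) \<le> (real \<Phi> / 2) * (real k * real \<tau>)"
      using upper by simp
    then have "real (card (networks B e - Good)) \<le> real \<Phi> / 2"
      using k1 \<tau> by (simp only: mult_le_cancel_right) auto
    moreover have "card (networks B e - Good) = \<Phi> - card Good" "card Good \<le> \<Phi>"
      unfolding \<Phi>_def by (auto simp: Good_def intro!: card_Diff_subset card_mono)
    ultimately show ?thesis by simp
  qed
  moreover have "real (card Good) \<le> (\<Sum>C'\<in>Sub. (3 * real \<gamma> ^ 2) ^ N)"
  proof -
    define W where "W C' = {\<phi> \<in> networks B e. \<forall>v\<in>words B e. (v, route \<phi> [] v) \<in> Q C'}" for C'
    \<comment> \<open>The cells probed by the queries of a good network are themselves one of the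
      sets in \<open>Sub\<close>, and all these queries are answerable from it.\<close>
    have "Good \<subseteq> (\<Union>C'\<in>Sub. W C')"
    proof
      fix \<phi> assume \<phi>: "\<phi> \<in> Good"
      define C' where "C' = (\<Union>v\<in>words B e. T (v, route \<phi> [] v))"
      have mem: "(v, route \<phi> [] v) \<in> words B e \<times> words B e" if "v \<in> words B e" for v
        using in_words that \<phi> by (auto simp: Good_def)
      have "card C' \<le> cost \<phi>" unfolding C'_def cost_def by (rule card_UN_le) simp
      then have "C' \<in> Sub" using \<phi> T[OF mem] unfolding Sub_def Good_def C'_def by auto
      moreover have "\<phi> \<in> W C'" using \<phi> mem by (auto simp: W_def Q_def Good_def C'_def)
      ultimately show "\<phi> \<in> (\<Union>C'\<in>Sub. W C')" by blast
    qed
    moreover have finW: "finite (W C')" for C' unfolding W_def by simp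
    moreover have finSub: "finite Sub" unfolding Sub_def using C(1) by simp
    ultimately have "card Good \<le> card (\<Union>C'\<in>Sub. W C')"
      by (intro card_mono) auto
    also have "\<dots> \<le> (\<Sum>C'\<in>Sub. card (W C'))"
      using finSub by (rule card_UN_le)
    finally have "card Good \<le> (\<Sum>C'\<in>Sub. card (W C'))" .
    then have "real (card Good) \<le> (\<Sum>C'\<in>Sub. real (card (W C')))"
      by (simp flip: of_nat_sum)
    also have "\<dots> \<le> (\<Sum>C'\<in>Sub. (3 * real \<gamma> ^ 2) ^ N)"
    proof (intro sum_mono)
      fix C' assume C': "C' \<in> Sub"
      have "real (card (W C')) \<le> (real \<gamma> ^ 2) ^ (e * B ^ e) * exp ((\<Sum>j<e. real (card (hits j (Q C')))) / real \<gamma> ^ 2)"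
        unfolding W_def using \<gamma> by (intro card_networks_within_le) (auto simp: Q_def)
      also have "\<dots> \<le> (real \<gamma> ^ 2) ^ N * exp (real N)"
      proof -
        have "(\<Sum>j<e. real (card (hits j (Q C')))) \<le> (\<Sum>j<e. real (\<gamma> ^ 2 * k))"
          using few[OF C'] by (intro sum_mono of_nat_mono less_imp_le) auto
        then have "(\<Sum>j<e. real (card (hits j (Q C')))) / real \<gamma> ^ 2 \<le> real N"
          using \<gamma> by (simp add: N_def field_simps)
        then show ?thesis using \<gamma> by (simp add: N_def k_def)
      qed
      also have "\<dots> \<le> (real \<gamma> ^ 2) ^ N * 3 ^ N"
        using power_mono[OF exp_le, of N] by (intro mult_left_mono) (auto simp flip: exp_of_nat_mult)
      finally show "real (card (W C')) \<le> (3 * real \<gamma> ^ 2) ^ N"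
        by (simp add: power_mult_distrib mult.commute)
    qed
    finally show ?thesis .
  qed
  \<comment> \<open>With y = B * u the exponent card C / y is at most k, and y \<le> B^2 =
    \<gamma>^8 bounds y^(k \<tau>) by \<gamma>^(8 k \<tau>) \<le> \<gamma>^N. This is where \<tau>
    has to be a small fraction of e.\<close>
  moreover have "real (card Sub) \<le> real \<gamma> ^ N * 3 ^ k"
  proof -
    have Bu: "real (B * u) \<ge> 1" using of_nat_mono[OF mult_le_mono[OF B1 C(3)], where 'a = real] by simp
    have "real (card Sub) \<le> real (B * u) ^ (k * \<tau>) * exp (real (card C) / real (B * u))"
      unfolding Sub_def by (intro card_small_subsets_le C(1) Bu)
    also have "\<dots> \<le> real \<gamma> ^ N * 3 ^ k"
    proof (intro mult_mono)
      have "B * u \<le> B * B" using C(4) by simp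
      also have "B * B = \<gamma> ^ 8" unfolding B by (simp flip: power_add)
      finally have "real (B * u) ^ (k * \<tau>) \<le> real (\<gamma> ^ 8) ^ (k * \<tau>)"
        by (intro power_mono of_nat_mono) auto
      also have "\<dots> = real \<gamma> ^ (k * (8 * \<tau>))" by (simp flip: power_mult add: mult_ac)
      also have "\<dots> \<le> real \<gamma> ^ N" unfolding N_def using \<gamma> \<tau> by (intro power_increasing) auto
      finally show "real (B * u) ^ (k * \<tau>) \<le> real \<gamma> ^ N" .
      have "real (card C) \<le> real k * real (B * u)" using of_nat_mono[OF C(2), where 'a = real] unfolding k_def by simp
      then have "real (card C) / real (B * u) \<le> real k" using Bu by (simp add: field_simps)
      then have "exp (real (card C) / real (B * u)) \<le> exp (real k)" by simp
      also have "\<dots> \<le> 3 ^ k" using power_mono[OF exp_le, of k] by (simp flip: exp_of_nat_mult)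
      finally show "exp (real (card C) / real (B * u)) \<le> 3 ^ k" .
    qed auto
    finally show ?thesis .
  qed
  ultimately have "real \<Phi> \<le> 2 * ((real \<gamma> ^ N * 3 ^ k) * (3 * real \<gamma> ^ 2) ^ N)"
  proof -
    assume a: "real \<Phi> \<le> 2 * real (card Good)" and b: "real (card Good) \<le> (\<Sum>C'\<in>Sub. (3 * real \<gamma> ^ 2) ^ N)"
      and c: "real (card Sub) \<le> real \<gamma> ^ N * 3 ^ k"
    have "real (card Sub) * (3 * real \<gamma> ^ 2) ^ N \<le> (real \<gamma> ^ N * 3 ^ k) * (3 * real \<gamma> ^ 2) ^ N"
      by (intro mult_right_mono c) auto
    with a b show ?thesis unfolding sum_constant by linarith
  qed
  \<comment> \<open>As k \<le> N, the factors 2 and 3^k are weakened to N-th powers, so that N-th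
    roots can be taken on both sides.\<close>
  also have "\<dots> \<le> 2 ^ N * ((real \<gamma> ^ N * 3 ^ N) * (3 * real \<gamma> ^ 2) ^ N)"
    using kN \<gamma> self_le_power[of "2::real" N] by (intro order_refl mult_mono power_increasing) auto
  also have "\<dots> = (18 * real \<gamma> ^ 3) ^ N"
  proof -
    have "18 * real \<gamma> ^ 3 = 2 * ((real \<gamma> * 3) * (3 * real \<gamma> ^ 2))"
      by (simp add: power2_eq_square power3_eq_cube)
    then show ?thesis by (simp only: power_mult_distrib)
  qed
  finally have "real \<Phi> \<le> (18 * real \<gamma> ^ 3) ^ N" .
  moreover have "(real B / 3) ^ N \<le> real \<Phi>"
  proof -
    have "(real B / 3) ^ N = ((real B / 3) ^ B) ^ card (contexts B e)"
      unfolding N_def k_def by (simp flip: power_mult card_contexts add: mult.commute)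
    also have "\<dots> \<le> fact B ^ card (contexts B e)"
      by (intro power_mono fact_ge_power_third) auto
    finally show ?thesis by (simp add: \<Phi>_def card_networks)
  qed
  ultimately have "(real B / 3) ^ N \<le> (18 * real \<gamma> ^ 3) ^ N" by linarith
  then have "real B / 3 \<le> 18 * real \<gamma> ^ 3"
    using kN by (subst (asm) power_mono_iff) auto
  then have "real \<gamma> ^ 3 * real \<gamma> \<le> real \<gamma> ^ 3 * 54" unfolding B by (simp add: power_numeral_reduce)
  then show False using \<gamma> by simp
qed

section \<open>Independent queries\<close>

primrec val :: "nat \<Rightarrow> nat list \<Rightarrow> nat" where
  "val B [] = 0"
| "val B (d # ds) = d * B ^ length ds + val B ds"

lemma val_append: "val B (xs @ ys) = val B xs * B ^ length ys + val B ys"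
  by (induction xs) (auto simp: algebra_simps power_add)

lemma val_less: "xs \<in> words B l \<Longrightarrow> val B xs < B ^ l"
proof (induction xs arbitrary: l)
  case (Cons d ds)
  then obtain l' where l': "l = Suc l'" by (auto simp: words_def)
  with Cons have "val B ds < B ^ l'" "d < B" "length ds = l'" by (auto dest: length_words)
  then have "val B (d # ds) < Suc d * B ^ l'" by simp
  also have "\<dots> \<le> B * B ^ l'" using \<open>d < B\<close> by (intro mult_right_mono) auto
  finally show ?case by (simp add: l')
qed (auto simp: words_def)

lemma inj_val: "inj_on (val B) (words B l)"
proof (induction l)
  case (Suc l)
  show ?case
  proof (rule inj_onI)
    fix xs ys assume *: "xs \<in> words B (Suc l)" "ys \<in> words B (Suc l)" "val B xs = val B ys"
    then obtain x xs' y ys' where eq: "xs = x # xs'" "ys = y # ys'"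
      by (cases xs; cases ys) (auto simp: words_def)
    with * have w: "xs' \<in> words B l" "ys' \<in> words B l" by auto
    have "x = y"
      using arg_cong[OF *(3), of "\<lambda>n. n div B ^ l"] val_less[OF w(1)] val_less[OF w(2)]
        length_words[OF w(1)] length_words[OF w(2)]
      by (cases "B ^ l = 0") (simp_all add: eq)
    with * w length_words[OF w(1)] length_words[OF w(2)] Suc show "xs = ys" by (auto simp: eq dest: inj_onD)
  qed
qed (auto simp: words_def inj_on_def)

lemma bij_val: "bij_betw (val B) (words B l) {..<B ^ l}"
  unfolding bij_betw_def
  using inj_val card_subset_eq[of "{..<B ^ l}" "val B ` words B l"]
  by (auto simp: card_image val_less image_subset_iff)

text \<open>
  Ordered by $r$, the incidence matrix between the queries and their points \<open>lead q\<close> is triangular.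
\<close>

definition staircase where
  "staircase Z D Q lead r \<longleftrightarrow> (\<forall>q\<in>Q. lead q \<in> Z \<and> D (lead q) q \<and>
     (\<forall>q'\<in>Q. q' \<noteq> q \<longrightarrow> D (lead q) q' \<longrightarrow> r q < (r q' :: nat)))"

text \<open>Back substitution: consistent assignments that agree off the leading points agree
  everywhere. Otherwise take a query with \<open>r\<close> minimal among those at whose leading
  point they differ. All other points that it dominates agree, so the equal answers force equality
  there as well. Hence restriction to the remaining points is injective.\<close>

lemma card_consistent_weights_le:
  fixes ans :: "'q \<Rightarrow> nat"
  assumes Z: "finite Z" and Q: "finite Q" and st: "staircase Z D Q lead r"
  shows "card {W \<in> (\<Pi>\<^sub>E z\<in>Z. {..<V::nat}). \<forall>q\<in>Q. (\<Sum>z\<in>{z\<in>Z. D z q}. W z) = ans q} \<le> V ^ (card Z - card Q)"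
proof -
  let ?S = "{W \<in> (\<Pi>\<^sub>E z\<in>Z. {..<V}). \<forall>q\<in>Q. (\<Sum>z\<in>{z\<in>Z. D z q}. W z) = ans q}"
  have lead: "lead q \<in> Z" "D (lead q) q" if "q \<in> Q" for q
    using st that by (auto simp: staircase_def)
  have less: "r q < r q'" if "q \<in> Q" "q' \<in> Q" "q' \<noteq> q" "D (lead q) q'" for q q'
    using st that by (auto simp: staircase_def)
  have inj: "inj_on lead Q"
  proof (rule inj_onI, rule ccontr)
    fix q q' assume *: "q \<in> Q" "q' \<in> Q" "lead q = lead q'" "q \<noteq> q'"
    then have "r q < r q'" "r q' < r q" using less[of q q'] less[of q' q] lead[of q] lead[of q'] by auto
    then show False by simp
  qed
  define Z' where "Z' = Z - lead ` Q"
  have "card Z' = card Z - card Q"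
    unfolding Z'_def using lead Q inj by (subst card_Diff_subset) (auto simp: card_image)
  have "inj_on (\<lambda>W. restrict W Z') ?S"
  proof (rule inj_onI, rule ccontr)
    fix W W' assume W: "W \<in> ?S" and W': "W' \<in> ?S" and eq: "restrict W Z' = restrict W' Z'" and ne: "W \<noteq> W'"
    have eq': "W z = W' z" if "z \<in> Z'" for z using fun_cong[OF eq, of z] that by simp
    have "\<exists>z\<in>Z. W z \<noteq> W' z"
      using ne W W' PiE_ext[of W Z "\<lambda>_. {..<V}" W'] by blast
    then have "\<exists>q. q \<in> Q \<and> W (lead q) \<noteq> W' (lead q)"
      using eq' unfolding Z'_def by blast
    then obtain q where q: "q \<in> Q" "W (lead q) \<noteq> W' (lead q)"
      and min: "\<And>q'. q' \<in> Q \<Longrightarrow> W (lead q') \<noteq> W' (lead q') \<Longrightarrow> r q \<le> r q'"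
      using ex_has_least_nat[of "\<lambda>q. q \<in> Q \<and> W (lead q) \<noteq> W' (lead q)" _ r] by blast
    have agree: "W z = W' z" if z: "z \<in> Z" "D z q" "z \<noteq> lead q" for z
    proof (cases "z \<in> lead ` Q")
      case True
      then obtain q' where "q' \<in> Q" "z = lead q'" by auto
      then show ?thesis using less[of q' q] min[of q'] q z by fastforce
    qed (use eq' z in \<open>auto simp: Z'_def\<close>)
    have "(\<Sum>z\<in>{z\<in>Z. D z q}. W z) = W (lead q) + (\<Sum>z\<in>{z\<in>Z. D z q} - {lead q}. W z)"
      using lead q Z by (intro sum.remove) auto
    moreover have "(\<Sum>z\<in>{z\<in>Z. D z q}. W' z) = W' (lead q) + (\<Sum>z\<in>{z\<in>Z. D z q} - {lead q}. W' z)"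
      using lead q Z by (intro sum.remove) auto
    moreover have "(\<Sum>z\<in>{z\<in>Z. D z q} - {lead q}. W z) = (\<Sum>z\<in>{z\<in>Z. D z q} - {lead q}. W' z)"
      using agree by (intro sum.cong) auto
    ultimately show False using W W' q by auto
  qed
  moreover have "(\<lambda>W. restrict W Z') ` ?S \<subseteq> (\<Pi>\<^sub>E z\<in>Z'. {..<V})"
    by (auto simp: Z'_def)
  ultimately have "card ?S \<le> card (\<Pi>\<^sub>E z\<in>Z'. {..<V})"
    using Z by (intro card_inj_on_le finite_PiE) (auto simp: Z'_def)
  also have "\<dots> = V ^ (card Z - card Q)"
    using Z \<open>card Z' = _\<close> by (simp add: card_PiE Z'_def)
  finally show ?thesis .
qed

text \<open>
  The leading point of a query in box $(a, b)$ is the one of box $(a - 1, b - 1)$. A query in another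
  box dominates it only from $a' \ge a - 1$ and $b' \ge b - 1$, so restricting both coordinates to
  one parity gives $a' \ge a$ and $b' \ge b$.
\<close>

lemma independent_queries:
  fixes D :: "nat list \<Rightarrow> nat list \<times> nat list \<Rightarrow> bool"
  assumes j: "j < e" and B: "B \<ge> 1" and Q: "Q \<subseteq> words B e \<times> words B e"
    and hits: "card (hits j Q) \<ge> (4 * \<rho> + 2) * B ^ e"
    and D1: "\<And>z v x. z \<in> words B (Suc e) \<Longrightarrow> v \<in> words B e \<Longrightarrow> x \<in> words B e \<Longrightarrow>
      val B (take (Suc j) z) < val B (take (Suc j) x) \<Longrightarrow>
      val B (rev (drop (Suc j) z)) < val B (rev (drop j v)) \<Longrightarrow> D z (v, x)"
    and D2: "\<And>z v x. z \<in> words B (Suc e) \<Longrightarrow> v \<in> words B e \<Longrightarrow> x \<in> words B e \<Longrightarrow> D z (v, x) \<Longrightarrow>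
      val B (take (Suc j) z) \<le> val B (take (Suc j) x) \<and>
      val B (rev (drop (Suc j) z)) \<le> val B (rev (drop j v))"
  shows "\<exists>Q' \<subseteq> Q. card Q' = \<rho> * B ^ e \<and> (\<exists>lead r. staircase (words B (Suc e)) D Q' lead r)"
proof -
  define g where "g = (\<lambda>(p, c). (val B p, val B (rev c)))"
  define f where "f = (\<lambda>(v, x). (val B (take (Suc j) x), val B (rev (drop j v))))"
  have hits_sub: "hits j Q \<subseteq> words B (Suc j) \<times> words B (e - j)"
    using Q j unfolding hits_def by (auto intro!: take_words drop_words)
  have "inj_on g (words B (Suc j) \<times> words B (e - j))"
    by (rule inj_onI) (auto simp: g_def dest!: inj_onD[OF inj_val])
  then have "card (g ` hits j Q) = card (hits j Q)"
    by (intro card_image) (rule inj_on_subset[OF _ hits_sub])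
  moreover have fg: "f ` Q = g ` hits j Q" unfolding hits_def f_def g_def by force
  ultimately have card_f: "card (f ` Q) \<ge> (4 * \<rho> + 2) * B ^ e" using hits by simp
  have f_sub: "f ` Q \<subseteq> {..<B ^ Suc j} \<times> {..<B ^ (e - j)}"
    unfolding fg using hits_sub
    by (auto simp: g_def simp del: power_Suc intro!: val_less dest!: subsetD)
  define I where "I s = {ab \<in> f ` Q. fst ab \<ge> 1 \<and> snd ab \<ge> 1 \<and> (fst ab mod 2, snd ab mod 2) = s}" for s
  have fin: "finite Q" using Q by (rule finite_subset) simp
  \<comment> \<open>Boxes in the first column or row have no diagonal predecessor, and there are at
    most 2 * B^e of them. The others fall into four parity classes, whence the constant 4 \<rho> +
    2.\<close>
  have "f ` Q \<subseteq> {0} \<times> {..<B ^ (e - j)} \<union> {..<B ^ Suc j} \<times> {0} \<union> (\<Union>s\<in>{0,1} \<times> {0,1}. I s)"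
  proof
    fix ab assume ab: "ab \<in> f ` Q"
    have "fst ab mod 2 \<in> {0,1}" "snd ab mod 2 \<in> {0,1}" by auto
    with ab subsetD[OF f_sub ab]
    show "ab \<in> {0} \<times> {..<B ^ (e - j)} \<union> {..<B ^ Suc j} \<times> {0} \<union> (\<Union>s\<in>{0,1} \<times> {0,1}. I s)"
      unfolding I_def by (cases ab; cases "fst ab = 0"; cases "snd ab = 0") auto
  qed
  then have "card (f ` Q) \<le> card ({0::nat} \<times> {..<B ^ (e - j)} \<union> {..<B ^ Suc j} \<times> {0::nat} \<union> (\<Union>s\<in>{0,1} \<times> {0,1}. I s))"
    using fin by (intro card_mono) (auto simp: I_def)
  also have "\<dots> \<le> B ^ (e - j) + B ^ Suc j + (\<Sum>s\<in>{0,1} \<times> {0,1}. card (I s))"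
    by (rule order_trans[OF card_Un_le add_mono[OF order_trans[OF card_Un_le add_mono] card_UN_le]])
       (auto simp: card_cartesian_product)
  also have "B ^ (e - j) \<le> B ^ e" using B by (intro power_increasing) auto
  also have "B ^ Suc j \<le> B ^ e" using B j by (intro power_increasing) auto
  finally have sum: "(\<Sum>s\<in>{0,1} \<times> {0,1::nat}. card (I s)) \<ge> 4 * (\<rho> * B ^ e)"
    using card_f by (simp add: algebra_simps)
  have "\<exists>s. card (I s) \<ge> \<rho> * B ^ e"
  proof (rule ccontr)
    assume "\<not> ?thesis"
    then have "card (I s) < \<rho> * B ^ e" for s by (meson not_le)
    then have "(\<Sum>s\<in>{0,1} \<times> {0,1::nat}. card (I s)) < (\<Sum>s\<in>{0,1::nat} \<times> {0,1::nat}. \<rho> * B ^ e)"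
      by (intro sum_strict_mono) auto
    with sum show False by simp
  qed
  then obtain s where "card (I s) \<ge> \<rho> * B ^ e" by auto
  then obtain J where J: "J \<subseteq> I s" "card J = \<rho> * B ^ e"
    by (meson obtain_subset_with_card_n)
  \<comment> \<open>One query is chosen for each box, so \<open>f\<close> is injective on the
    selection.\<close>
  define Q' where "Q' = inv_into Q f ` J"
  have JQ: "J \<subseteq> f ` Q" using J(1) by (auto simp: I_def)
  have "card Q' = \<rho> * B ^ e"
    unfolding Q'_def using inj_on_inv_into[OF JQ] J(2) by (simp add: card_image)
  moreover have Q': "Q' \<subseteq> Q" unfolding Q'_def using JQ by (intro image_subsetI inv_into_into) blast
  have f_inv: "f (inv_into Q f y) = y" if "y \<in> J" for y
    using that JQ by (intro f_inv_into_f) blast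
  have f_Q': "f q \<in> J" if "q \<in> Q'" for q
    using that f_inv unfolding Q'_def by (elim imageE) simp
  have f_inj: "q = q'" if "q \<in> Q'" "q' \<in> Q'" "f q = f q'" for q q'
    using that f_inv unfolding Q'_def by (elim imageE) simp
  define lead where "lead q = (SOME z. z \<in> words B (Suc e) \<and>
    val B (take (Suc j) z) = fst (f q) - 1 \<and> val B (rev (drop (Suc j) z)) = snd (f q) - 1)" for q
  have lead: "lead q \<in> words B (Suc e)" "val B (take (Suc j) (lead q)) = fst (f q) - 1"
    "val B (rev (drop (Suc j) (lead q))) = snd (f q) - 1" if q: "q \<in> Q'" for q
  proof -
    have "f q \<in> {..<B ^ Suc j} \<times> {..<B ^ (e - j)}"
      using f_sub JQ f_Q'[OF q] by blast
    then have "fst (f q) < B ^ Suc j" "snd (f q) < B ^ (e - j)"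
      by (simp_all only: mem_Times_iff lessThan_iff)
    then have "fst (f q) - 1 \<in> val B ` words B (Suc j)" "snd (f q) - 1 \<in> val B ` words B (e - j)"
      using bij_val[of B] unfolding bij_betw_def by (auto simp del: power_Suc)
    then obtain p c where pc: "p \<in> words B (Suc j)" "c \<in> words B (e - j)"
      "val B p = fst (f q) - 1" "val B c = snd (f q) - 1" by auto
    have "p @ rev c \<in> words B (Suc j + (e - j))" using pc by (intro append_words) auto
    then have "\<exists>z. z \<in> words B (Suc e) \<and>
      val B (take (Suc j) z) = fst (f q) - 1 \<and> val B (rev (drop (Suc j) z)) = snd (f q) - 1"
      using pc j length_words[OF pc(1)] by (intro exI[of _ "p @ rev c"]) auto
    from someI_ex[OF this] show "lead q \<in> words B (Suc e)" "val B (take (Suc j) (lead q)) = fst (f q) - 1"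
      "val B (rev (drop (Suc j) (lead q))) = snd (f q) - 1" unfolding lead_def by auto
  qed
  have pos: "fst (f q) \<ge> 1" "snd (f q) \<ge> 1" "(fst (f q) mod 2, snd (f q) mod 2) = s" if "q \<in> Q'" for q
    using f_Q'[OF that] J(1) by (auto simp: I_def)
  \<comment> \<open>Another query above the leading point has both box coordinates at least as large
    and lies in a different box, so the sum of the coordinates grows strictly.\<close>
  have "staircase (words B (Suc e)) D Q' lead (\<lambda>q. fst (f q) + snd (f q))"
    unfolding staircase_def
  proof (intro ballI conjI impI)
    fix q assume q: "q \<in> Q'"
    obtain v x where vx: "q = (v, x)" by (cases q)
    then have "v \<in> words B e" "x \<in> words B e" using q Q Q' by auto
    show "lead q \<in> words B (Suc e)" using lead q by auto
    show "D (lead q) q"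
      unfolding vx by (rule D1) (use lead[OF q] pos[OF q] \<open>v \<in> _\<close> \<open>x \<in> _\<close> in \<open>auto simp: vx f_def\<close>)
  next
    fix q q' assume q: "q \<in> Q'" "q' \<in> Q'" "q' \<noteq> q" "D (lead q) q'"
    obtain v x where vx: "q' = (v, x)" by (cases q')
    then have "v \<in> words B e" "x \<in> words B e" using q Q Q' by auto
    from D2[OF lead(1)[OF q(1)] this] q(4) lead[OF q(1)]
    have *: "fst (f q) - 1 \<le> fst (f q')" "snd (f q) - 1 \<le> snd (f q')" by (auto simp: vx f_def)
    have mods: "fst (f q) mod 2 = fst (f q') mod 2" "snd (f q) mod 2 = snd (f q') mod 2"
      using pos[OF q(1)] pos[OF q(2)] by auto
    have par: "a \<le> a'" if "a - 1 \<le> a'" "1 \<le> a" "a mod 2 = a' mod 2" for a a' :: nat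
      using that by presburger
    note par[OF *(1) pos(1)[OF q(1)] mods(1)] par[OF *(2) pos(2)[OF q(1)] mods(2)]
    moreover have "f q \<noteq> f q'" using f_inj[OF q(1,2)] q(3) by auto
    ultimately show "fst (f q) + snd (f q) < fst (f q') + snd (f q')"
      by (auto simp: prod_eq_iff)
  qed
  with \<open>card Q' = _\<close> Q' show ?thesis by blast
qed

section \<open>Encoding the weights of one epoch\<close>

lemma probed_cells_finite [simp]: "finite (probed_cells P m)"
  by (induction P arbitrary: m) auto

text \<open>It is enough to know the cells of one of the two runs: the other one reads the same
  contents, hence follows the same branches and makes the same writes.\<close>

lemma result_cong:
  "(\<And>a. a \<in> probed_cells P m \<Longrightarrow> m' a = m a) \<Longrightarrow> result P m' = result P m"
proof (induction P arbitrary: m m')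
  case (Read a k)
  have "m' a = m a" by (rule Read.prems) simp
  moreover have "result (k (m a)) m' = result (k (m a)) m"
    by (rule Read.IH[OF rangeI]) (rule Read.prems, simp)
  ultimately show ?case by simp
next
  case (Write a c P)
  have "result P (m'(a := c)) = result P (m(a := c))"
  proof (rule Write.IH)
    fix x assume "x \<in> probed_cells P (m(a := c))"
    then have "x \<in> probed_cells (Write a c P) m" by simp
    from Write.prems[OF this] show "(m'(a := c)) x = (m(a := c)) x" by simp
  qed
  then show ?case by simp
qed simp

lemma final_memory_unprobed: "a \<notin> probed_cells P m \<Longrightarrow> final_memory P m a = m a"
  by (induction P arbitrary: m) auto

lemma fits_probed_cells:
  "fits w P \<Longrightarrow> (\<And>a. m a < 2 ^ w) \<Longrightarrow> probed_cells P m \<subseteq> {..<2 ^ w}"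
  by (induction P arbitrary: m) auto

lemma fits_final_memory:
  "fits w P \<Longrightarrow> (\<And>a. m a < 2 ^ w) \<Longrightarrow> final_memory P m a < 2 ^ w"
  by (induction P arbitrary: m a) auto

text \<open>Of the b \<rho> k bits in the answers one half pays for naming the queries, 2 lg k bits
  each, and the other half for the cells, 2 w bits each. Squaring both sides expresses the halves
  without dividing b. The factor 6 is 3 from exp 1 \<le> 3 times 2 for half of all weights.\<close>

lemma encoding_budget:
  fixes k \<rho> w s b :: nat
  assumes "k ^ 4 \<le> 2 ^ b" "6 + 4 * (w * s) \<le> b * (\<rho> * k)"
  shows "6 * (k ^ 2) ^ (\<rho> * k) * (2 ^ (2 * w)) ^ s \<le> (2 ^ b) ^ (\<rho> * k)"
proof (rule power2_le_imp_le)
  have "(6 * (k ^ 2) ^ (\<rho> * k) * (2 ^ (2 * w)) ^ s)\<^sup>2 = 36 * (k ^ 4) ^ (\<rho> * k) * 2 ^ (4 * (w * s))"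
    by (simp add: power_mult_distrib mult_ac flip: power_mult)
  also have "\<dots> \<le> 2 ^ 6 * (2 ^ b) ^ (\<rho> * k) * 2 ^ (4 * (w * s))"
    using assms(1) by (intro mult_mono power_mono) auto
  also have "\<dots> = 2 ^ (b * (\<rho> * k)) * 2 ^ (6 + 4 * (w * s))"
    by (simp add: power_add power_mult[of 2 b])
  also have "\<dots> \<le> 2 ^ (b * (\<rho> * k)) * 2 ^ (b * (\<rho> * k))"
    using assms(2) by (intro mult_left_mono power_increasing) auto
  also have "\<dots> = ((2 ^ b) ^ (\<rho> * k))\<^sup>2"
    by (simp add: power_mult[of 2 b] power2_eq_square)
  finally show "(6 * (k ^ 2) ^ (\<rho> * k) * (2 ^ (2 * w)) ^ s)\<^sup>2 \<le> ((2 ^ b) ^ (\<rho> * k))\<^sup>2" .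
qed simp

text \<open>\<open>C W\<close> stands for the cells of the epoch, \<open>L W\<close> for those of
  the later epochs, \<open>M0\<close> for the memory before the epoch and \<open>base\<close> for
  the contribution of all other insertions; the decoder knows the last two. At least half of all
  weights are not \<open>Bad\<close>, and each of these costs more than k^2 \<tau> / 2, which gives
  the constant 1/4.\<close>

lemma epoch_probes_ge:
  fixes M0 :: memory and M :: "(nat list \<Rightarrow> nat) \<Rightarrow> memory"
    and P :: "nat list \<times> nat list \<Rightarrow> nat cell_prog"
    and D :: "nat list \<Rightarrow> nat list \<times> nat list \<Rightarrow> bool"
    and B \<gamma> \<tau> \<rho> e u w b :: nat
  defines "Z \<equiv> words B (Suc e)" and "k \<equiv> B ^ e" and "\<Q> \<equiv> words B e \<times> words B e"
  defines "\<W> \<equiv> (\<Pi>\<^sub>E z\<in>Z. {..<2 ^ b :: nat})"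
  assumes \<gamma>: "\<gamma> > 54" and B: "B = \<gamma> ^ 4" and u: "u \<ge> 1" "u \<le> B"
    and \<tau>: "1 \<le> \<tau>" "8 * \<tau> \<le> e" and \<rho>: "4 * \<rho> + 2 \<le> \<gamma>\<^sup>2"
    and small: "B ^ (4 * e) \<le> 2 ^ b" and budget: "6 + 4 * (w * (\<tau> + 2 * u)) \<le> b * \<rho>"
    and C: "\<And>W. W \<in> \<W> \<Longrightarrow> finite (C W) \<and> card (C W) \<le> k * B * u \<and> C W \<subseteq> {..<2 ^ w}"
    and L: "\<And>W. W \<in> \<W> \<Longrightarrow> finite (L W) \<and> card (L W) \<le> 2 * k * u \<and> L W \<subseteq> {..<2 ^ w}"
    and M: "\<And>W a. W \<in> \<W> \<Longrightarrow> M W a < 2 ^ w"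
    and M0: "\<And>W a. W \<in> \<W> \<Longrightarrow> a \<notin> C W \<Longrightarrow> a \<notin> L W \<Longrightarrow> M W a = M0 a"
    and correct: "\<And>W q. W \<in> \<W> \<Longrightarrow> q \<in> \<Q> \<Longrightarrow>
      result (P q) (M W) = base q + (\<Sum>z\<in>{z\<in>Z. D z q}. W z)"
    and D1: "\<And>j z v x. j < e \<Longrightarrow> z \<in> words B (Suc e) \<Longrightarrow> v \<in> words B e \<Longrightarrow> x \<in> words B e \<Longrightarrow>
      val B (take (Suc j) z) < val B (take (Suc j) x) \<Longrightarrow>
      val B (rev (drop (Suc j) z)) < val B (rev (drop j v)) \<Longrightarrow> D z (v, x)"
    and D2: "\<And>j z v x. j < e \<Longrightarrow> z \<in> words B (Suc e) \<Longrightarrow> v \<in> words B e \<Longrightarrow> x \<in> words B e \<Longrightarrow> D z (v, x) \<Longrightarrow>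
      val B (take (Suc j) z) \<le> val B (take (Suc j) x) \<and>
      val B (rev (drop (Suc j) z)) \<le> val B (rev (drop j v))"
  shows "real (card \<W>) * (real k ^ 2 * real \<tau> / 4) \<le>
    (\<Sum>W\<in>\<W>. \<Sum>q\<in>\<Q>. real (card (probed_cells (P q) (M W) \<inter> C W)))"
proof -
  define cost where "cost W = (\<Sum>q\<in>\<Q>. real (card (probed_cells (P q) (M W) \<inter> C W)))" for W
  define Bad where "Bad = {W \<in> \<W>. cost W \<le> real k ^ 2 * real \<tau> / 2}"
  \<comment> \<open>There are k \<tau> sampled cells and at most 2 k u later cells; the latter are
    all encoded.\<close>
  define s where "s = k * (\<tau> + 2 * u)"
  \<comment> \<open>An encoded cell is a pair of an address and a content.\<close>
  define V where "V = {..<2 ^ w :: nat} \<times> {..<2 ^ w :: nat}"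
  define Mus where "Mus = {\<mu>. \<mu> \<subseteq> V \<and> card \<mu> \<le> s}"
  define Qs where "Qs = {Q. Q \<subseteq> \<Q> \<and> card Q = \<rho> * k \<and> (\<exists>lead r. staircase Z D Q lead r)}"
  txt \<open>
    The decoder patches the memory before the epoch with the encoded cells. On the queries in $Q$
    this is indistinguishable from the final memory.
  \<close>
  define dec where "dec \<mu> a = (if \<exists>c. (a, c) \<in> \<mu> then SOME c. (a, c) \<in> \<mu> else M0 a)"
    for \<mu> :: "(nat \<times> nat) set" and a
  define consistent where "consistent Q \<mu> = {W \<in> \<W>. \<forall>q\<in>Q. (\<Sum>z\<in>{z\<in>Z. D z q}. W z) =
     result (P q) (dec \<mu>) - base q}" for Q \<mu>
  have fin [simp]: "finite \<W>" "finite Z" "finite \<Q>" unfolding \<W>_def Z_def \<Q>_def by (auto intro: finite_PiE)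
  have B1: "B \<ge> 1" and k1: "k \<ge> 1" using \<gamma> B by (auto simp: k_def)
  have card_Z: "card Z = k * B" by (simp add: Z_def k_def)
  have card_W: "card \<W> = (2 ^ b) ^ card Z" by (simp add: \<W>_def card_PiE)
  have covered: "\<exists>Q\<in>Qs. \<exists>\<mu>\<in>Mus. W \<in> consistent Q \<mu>" if "W \<in> Bad" for W
  proof -
    have W: "W \<in> \<W>" using that by (simp add: Bad_def)
    have "\<exists>C' \<subseteq> C W. card C' \<le> B ^ e * \<tau> \<and> (\<exists>j<e. \<gamma> ^ 2 * B ^ e \<le>
        card (hits j {q \<in> words B e \<times> words B e. probed_cells (P q) (M W) \<inter> C W \<subseteq> C'}))"
    proof (rule butterfly_cell_sampling[OF \<gamma> B _ _ u _ \<tau>])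
      show "(\<Sum>q\<in>words B e \<times> words B e. real (card (probed_cells (P q) (M W) \<inter> C W)))
         \<le> real (B ^ e) ^ 2 * real \<tau> / 2"
        using that unfolding Bad_def cost_def \<Q>_def k_def by simp
    qed (use C[OF W] in \<open>auto simp: k_def mult.assoc\<close>)
    then obtain C' j where C': "C' \<subseteq> C W" "card C' \<le> k * \<tau>" and j: "j < e"
      "\<gamma> ^ 2 * k \<le> card (hits j {q \<in> \<Q>. probed_cells (P q) (M W) \<inter> C W \<subseteq> C'})"
      unfolding k_def \<Q>_def by blast
    have "(4 * \<rho> + 2) * B ^ e \<le> card (hits j {q \<in> \<Q>. probed_cells (P q) (M W) \<inter> C W \<subseteq> C'})"
      using mult_right_mono[OF \<rho>, of k] j(2) unfolding k_def by linarith
    then have "\<exists>Q \<subseteq> {q \<in> \<Q>. probed_cells (P q) (M W) \<inter> C W \<subseteq> C'}. card Q = \<rho> * B ^ e \<and>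
        (\<exists>lead r. staircase (words B (Suc e)) D Q lead r)"
      by (rule independent_queries[OF j(1) B1, rotated]) (auto simp: \<Q>_def intro: D1[OF j(1)] dest: D2[OF j(1)])
    then obtain Q lead r where Q: "Q \<subseteq> {q \<in> \<Q>. probed_cells (P q) (M W) \<inter> C W \<subseteq> C'}" "card Q = \<rho> * k"
      "staircase Z D Q lead r"
      unfolding k_def Z_def by blast
    define \<mu> where "\<mu> = (\<lambda>a. (a, M W a)) ` (C' \<union> L W)"
    have "card \<mu> \<le> card (C' \<union> L W)"
      unfolding \<mu>_def using C[OF W] L[OF W] C'(1) by (intro card_image_le) (auto dest: finite_subset)
    also have "\<dots> \<le> card C' + card (L W)" by (rule card_Un_le)
    also have "\<dots> \<le> s" using C'(2) L[OF W] by (auto simp: s_def algebra_simps)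
    finally have "\<mu> \<in> Mus"
      using C[OF W] L[OF W] C'(1) M[OF W] by (auto simp: Mus_def \<mu>_def V_def)
    moreover have "Q \<in> Qs" using Q by (auto simp: Qs_def)
    moreover have "W \<in> consistent Q \<mu>"
    proof -
      have "result (P q) (dec \<mu>) = result (P q) (M W)" if "q \<in> Q" for q
      proof (rule result_cong)
        \<comment> \<open>A probed cell of \<open>C W\<close> lies in C' by the choice of Q, a later
          cell is encoded in any case, and every other cell still has its content from before the
          epoch.\<close>
        fix a assume "a \<in> probed_cells (P q) (M W)"
        with Q(1) that have "a \<in> C W \<Longrightarrow> a \<in> C'" by auto
        moreover have "(a, c) \<in> \<mu> \<longleftrightarrow> a \<in> C' \<union> L W \<and> c = M W a" for c
          by (auto simp: \<mu>_def)
        ultimately show "dec \<mu> a = M W a"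
          using M0[OF W, of a] by (cases "a \<in> C W") (auto simp: dec_def)
      qed
      then show ?thesis using Q(1) W correct[OF W] by (auto simp: consistent_def)
    qed
    ultimately show ?thesis by blast
  qed
  have finV: "finite V" and card_V: "card V = 2 ^ (2 * w)"
    by (auto simp: V_def card_cartesian_product simp flip: power_add)
  have finMus: "finite Mus" and finQs: "finite Qs" using finV by (auto simp: Mus_def Qs_def)
  have card_Mus: "real (card Mus) \<le> 3 * (2 ^ (2 * w)) ^ s"
  proof -
    have "real (card Mus) \<le> (2 ^ (2 * w)) ^ s * exp (real (card V) / 2 ^ (2 * w))"
      unfolding Mus_def by (intro card_small_subsets_le finV) simp
    also have "\<dots> \<le> (2 ^ (2 * w)) ^ s * 3"
      using exp_le by (intro mult_left_mono) (auto simp: card_V)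
    finally show ?thesis by simp
  qed
  have card_Qs: "card Qs \<le> (k ^ 2) ^ (\<rho> * k)"
  proof -
    have "card Qs \<le> card {Q. Q \<subseteq> \<Q> \<and> card Q = \<rho> * k}"
      by (intro card_mono) (auto simp: Qs_def)
    also have "\<dots> = card \<Q> choose (\<rho> * k)" by (simp add: n_subsets)
    also have "\<dots> \<le> card \<Q> ^ (\<rho> * k)"
      by (cases "\<rho> * k \<le> card \<Q>") (auto simp: binomial_le_pow binomial_eq_0)
    finally show ?thesis by (simp add: \<Q>_def k_def power2_eq_square)
  qed
  \<comment> \<open>Independence pays off here: given Q, \<mu> and the other weights, \<rho> k of
    the b-bit weights are determined.\<close>
  have card_con: "card (consistent Q \<mu>) \<le> (2 ^ b) ^ (card Z - \<rho> * k)" if Q: "Q \<in> Qs" for Q \<mu>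
  proof -
    from Q obtain lead r where *: "staircase Z D Q lead r" "card Q = \<rho> * k" "Q \<subseteq> \<Q>" by (auto simp: Qs_def)
    then have "finite Q" by (auto intro: finite_subset)
    from card_consistent_weights_le[OF fin(2) this *(1), of "2 ^ b"] show ?thesis
      using *(2) by (simp add: consistent_def \<W>_def)
  qed
  have "2 * real (card Bad) \<le> real (card \<W>)"
  proof -
    have "Bad \<subseteq> (\<Union>(Q, \<mu>)\<in>Qs \<times> Mus. consistent Q \<mu>)" using covered by fast
    then have "card Bad \<le> card (\<Union>(Q, \<mu>)\<in>Qs \<times> Mus. consistent Q \<mu>)"
      using finMus finQs by (intro card_mono) (auto simp: consistent_def)
    also have "\<dots> \<le> (\<Sum>(Q, \<mu>)\<in>Qs \<times> Mus. card (consistent Q \<mu>))"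
      using card_UN_le[of "Qs \<times> Mus" "\<lambda>(Q, \<mu>). consistent Q \<mu>"] finMus finQs by (simp add: split_def)
    also have "\<dots> \<le> (\<Sum>(Q, \<mu>)\<in>Qs \<times> Mus. (2 ^ b) ^ (card Z - \<rho> * k))"
      using card_con by (intro sum_mono) auto
    also have "\<dots> = card Qs * card Mus * (2 ^ b) ^ (card Z - \<rho> * k)"
      by (simp add: split_def card_cartesian_product)
    finally have "real (card Bad) \<le> real (card Qs * card Mus * (2 ^ b) ^ (card Z - \<rho> * k))"
      by (rule of_nat_mono)
    then have "real (card Bad) \<le> real (card Qs) * real (card Mus) * (2 ^ b) ^ (card Z - \<rho> * k)"
      by simp
    also have "\<dots> \<le> real ((k ^ 2) ^ (\<rho> * k)) * (3 * (2 ^ (2 * w)) ^ s) * (2 ^ b) ^ (card Z - \<rho> * k)"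
      using card_Mus card_Qs by (intro mult_mono of_nat_mono) auto
    finally have "2 * real (card Bad) \<le>
        real (6 * (k ^ 2) ^ (\<rho> * k) * (2 ^ (2 * w)) ^ s) * (2 ^ b) ^ (card Z - \<rho> * k)"
      by (simp add: mult_ac)
    also have "\<dots> \<le> real ((2 ^ b) ^ (\<rho> * k)) * (2 ^ b) ^ (card Z - \<rho> * k)"
    proof (intro mult_right_mono of_nat_mono encoding_budget)
      show "k ^ 4 \<le> 2 ^ b" using small by (simp add: k_def mult.commute flip: power_mult)
      have "6 + 4 * (w * s) \<le> k * (6 + 4 * (w * (\<tau> + 2 * u)))"
        using k1 by (simp add: s_def algebra_simps)
      also have "\<dots> \<le> k * (b * \<rho>)" using budget by (intro mult_left_mono) auto
      finally show "6 + 4 * (w * s) \<le> b * (\<rho> * k)" by (simp add: mult_ac)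
    qed auto
    \<comment> \<open>The truncated subtraction in the exponent is exact because \<rho> k is at most
      the number of points.\<close>
    also have "\<dots> = (2 ^ b) ^ card Z"
    proof -
      have "\<rho> \<le> \<gamma> ^ 2" using \<rho> by linarith
      also have "\<dots> \<le> B" unfolding B using \<gamma> by (intro power_increasing) auto
      finally have "\<rho> * k \<le> card Z" by (simp add: card_Z)
      then show ?thesis by (simp flip: power_add)
    qed
    finally show ?thesis by (simp add: card_W)
  qed
  moreover have "Bad \<subseteq> \<W>" by (auto simp: Bad_def)
  then have "real (card (\<W> - Bad)) = real (card \<W>) - real (card Bad)"
    using card_mono[OF fin(1)] by (simp add: card_Diff_subset finite_subset[OF _ fin(1)] of_nat_diff)
  ultimately have "real (card \<W>) / 2 \<le> real (card (\<W> - Bad))" by linarith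
  then have "real (card \<W>) / 2 * (real k ^ 2 * real \<tau> / 2) \<le> real (card (\<W> - Bad)) * (real k ^ 2 * real \<tau> / 2)"
    by (intro mult_right_mono) auto
  also have "\<dots> = (\<Sum>W\<in>\<W> - Bad. real k ^ 2 * real \<tau> / 2)" by simp
  also have "\<dots> \<le> (\<Sum>W\<in>\<W> - Bad. cost W)" by (intro sum_mono) (auto simp: Bad_def)
  also have "\<dots> \<le> (\<Sum>W\<in>\<W>. cost W)" by (intro sum_mono2) (auto simp: cost_def sum_nonneg)
  finally show ?thesis by (simp add: cost_def)
qed

section \<open>Sequences of updates\<close>

abbreviation exec :: "range_ds \<Rightarrow> (point \<times> nat) list \<Rightarrow> memory \<Rightarrow> memory" where
  "exec D U \<equiv> fold (\<lambda>(p, v). final_memory (insert_prog D p v)) U"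

primrec touched :: "range_ds \<Rightarrow> (point \<times> nat) list \<Rightarrow> memory \<Rightarrow> nat set" where
  "touched D [] m = {}"
| "touched D (pv # U) m = probed_cells (insert_prog D (fst pv) (snd pv)) m \<union>
     touched D U (final_memory (insert_prog D (fst pv) (snd pv)) m)"

lemma memory_after_append: "memory_after D (U @ V) = exec D V (memory_after D U)"
  by (simp add: memory_after_def)

lemma exec_untouched: "a \<notin> touched D U m \<Longrightarrow> exec D U m a = m a"
  by (induction U arbitrary: m) (auto simp: final_memory_unprobed split_def)

lemma finite_touched [simp]: "finite (touched D U m)"
  by (induction U arbitrary: m) auto

lemma finite_grid [simp]: "finite (grid n)"
  by (simp add: grid_def)

lemma finite_insertions [simp]: "finite (insertions n b)"
proof (rule finite_subset)
  show "insertions n b \<subseteq> {U. set U \<subseteq> grid n \<times> {0..<2 ^ b} \<and> length U \<le> n}"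
    by (auto simp: insertions_def)
qed (rule finite_lists_length_le, simp)

lemma insertions_prefix: "U @ V \<in> insertions n b \<Longrightarrow> U \<in> insertions n b"
  by (auto simp: insertions_def)

lemma card_probed_cells_le_update_time:
  assumes "U @ [(p, v)] \<in> insertions n b"
  shows "card (probed_cells (insert_prog D p v) (memory_after D U)) \<le> update_time n b D"
  unfolding update_time_def
proof (rule Max_ge)
  \<comment> \<open>The comprehension ranges over infinite types. Splitting off the last insertion
    exhibits it as part of the image of a finite set.\<close>
  have "{card (probed_cells (insert_prog D p v) (memory_after D U)) | U p v. U @ [(p, v)] \<in> insertions n b}
    \<subseteq> (\<lambda>X. card (probed_cells (insert_prog D (fst (last X)) (snd (last X))) (memory_after D (butlast X)))) ` insertions n b"
    by (force intro: image_eqI)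
  then show "finite {card (probed_cells (insert_prog D p v) (memory_after D U)) | U p v. U @ [(p, v)] \<in> insertions n b}"
    by (rule finite_subset) simp
qed (use assms in blast)

lemma card_touched_le:
  "U @ V \<in> insertions n b \<Longrightarrow> card (touched D V (memory_after D U)) \<le> length V * update_time n b D"
proof (induction V arbitrary: U)
  case (Cons pv V)
  obtain p v where pv: "pv = (p, v)" by (cases pv)
  have "(U @ [pv]) @ V \<in> insertions n b" using Cons.prems by simp
  from Cons.IH[OF this] have "card (touched D V (final_memory (insert_prog D p v) (memory_after D U))) \<le> length V * update_time n b D"
    by (simp add: memory_after_append pv)
  moreover have "card (probed_cells (insert_prog D p v) (memory_after D U)) \<le> update_time n b D"
    using insertions_prefix[of "U @ [pv]" V n b] Cons.prems pv by (intro card_probed_cells_le_update_time) simp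
  ultimately show ?case
    using card_Un_le[of "probed_cells (insert_prog D p v) (memory_after D U)"
        "touched D V (final_memory (insert_prog D p v) (memory_after D U))"]
    by (simp add: pv)
qed simp

lemma exec_fits:
  assumes "is_range_ds w n b D" "set V \<subseteq> grid n \<times> {0..<2 ^ b}" "\<And>a. m a < 2 ^ w"
  shows "exec D V m a < 2 ^ w \<and> touched D V m \<subseteq> {..<2 ^ w}"
  using assms(2-)
proof (induction V arbitrary: m)
  case (Cons pv V)
  obtain p v where pv: "pv = (p, v)" by (cases pv)
  have f: "fits w (insert_prog D p v)"
    using assms(1) Cons.prems(1) unfolding is_range_ds_def pv by auto
  have m: "final_memory (insert_prog D p v) m a < 2 ^ w" for a
    by (rule fits_final_memory[OF f Cons.prems(2)])
  have "exec D V (final_memory (insert_prog D p v) m) a < 2 ^ w \<and>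
      touched D V (final_memory (insert_prog D p v) m) \<subseteq> {..<2 ^ w}"
    using Cons.prems(1) m by (intro Cons.IH) auto
  then show ?case using fits_probed_cells[OF f Cons.prems(2)] by (simp add: pv)
qed simp

lemma memory_after_fits:
  assumes "is_range_ds w n b D" "U \<in> insertions n b"
  shows "memory_after D U a < 2 ^ w"
  using exec_fits[OF assms(1), of U "initial D" a] assms
  by (auto simp: memory_after_def insertions_def is_range_ds_def)

lemma range_sum_append: "range_sum (U @ V) q = range_sum U q + range_sum V q"
  by (simp add: range_sum_def)

section \<open>The hard distribution\<close>

context
  fixes n B E :: nat
begin

text \<open>The spacing of the points of epoch e. The common factor \<open>n div B ^ Suc E\<close>
  makes all epochs fill the same square, whose side is n rounded down to a multiple of
  \<open>B ^ Suc E\<close>.\<close>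

definition side :: "nat \<Rightarrow> nat" where
  "side e = n div B ^ Suc E * B ^ (E - e)"

text \<open>
  The offset $e$ makes the epochs disjoint: it is the x-coordinate modulo \<open>n div B ^ Suc E\<close>.
\<close>

definition pt :: "nat \<Rightarrow> nat list \<Rightarrow> point" where
  "pt e z = (val B z * side e + e, val B (rev z) * side e)"

definition batch :: "nat \<Rightarrow> (nat list \<Rightarrow> nat) \<Rightarrow> (point \<times> nat) list" where
  "batch e W = map (\<lambda>z. (pt e z, W z)) (List.n_lists (Suc e) [0..<B])"

text \<open>\<open>rev\<close> puts the large epochs first. What follows epoch e is then
  \<open>batches Ws 0 e\<close>, a geometric sum of at most 2 * B^e insertions if B \<ge> 2.\<close>

definition batches :: "(nat \<Rightarrow> nat list \<Rightarrow> nat) \<Rightarrow> nat \<Rightarrow> nat \<Rightarrow> (point \<times> nat) list" where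
  "batches Ws l h = concat (map (\<lambda>e. batch e (Ws e)) (rev [l..<h]))"

text \<open>Words locate a query only up to a square of side \<open>side e * B\<close>; the residues
  rx and ry fix its position inside.\<close>

definition dominated :: "nat \<Rightarrow> nat \<Rightarrow> nat \<Rightarrow> nat list \<Rightarrow> nat list \<times> nat list \<Rightarrow> bool" where
  "dominated rx ry e z = (\<lambda>(v, x). fst (pt e z) \<le> val B x * (side e * B) + rx \<and>
      snd (pt e z) \<le> val B (rev v) * (side e * B) + ry)"

lemma set_n_lists_words: "set (List.n_lists l [0..<B]) = words B l"
  by (auto simp: set_n_lists words_def)

lemma length_batch [simp]: "length (batch e W) = B ^ Suc e"
  by (simp add: batch_def length_n_lists del: n_lists.simps)

lemma batches_split: "l \<le> e \<Longrightarrow> e < h \<Longrightarrow>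
  batches Ws l h = batches Ws (Suc e) h @ batch e (Ws e) @ batches Ws l e"
proof -
  assume "l \<le> e" "e < h"
  then have "[l..<h] = [l..<e] @ e # [Suc e..<h]"
    using upt_add_eq_append[of l e "h - e"] by (simp add: upt_conv_Cons)
  then show ?thesis by (simp add: batches_def)
qed

lemma batches_cong: "(\<And>e. l \<le> e \<Longrightarrow> e < h \<Longrightarrow> Ws e = Ws' e) \<Longrightarrow> batches Ws l h = batches Ws' l h"
  unfolding batches_def by (intro arg_cong[where f = concat] map_cong) auto

lemma length_batches: "length (batches Ws l h) = (\<Sum>e\<in>{l..<h}. B ^ Suc e)"
proof (induction h)
  case (Suc h)
  then show ?case by (cases "l \<le> h") (auto simp: batches_def atLeastLessThanSuc)
qed (simp add: batches_def)

lemma range_sum_batch: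
  "range_sum (batch e W) q = (\<Sum>z\<in>{z \<in> words B (Suc e). fst (pt e z) \<le> fst q \<and> snd (pt e z) \<le> snd q}. W z)"
proof -
  have "range_sum (batch e W) q = sum_list (map (\<lambda>z. if fst (pt e z) \<le> fst q \<and> snd (pt e z) \<le> snd q then W z else 0)
      (List.n_lists (Suc e) [0..<B]))"
    unfolding range_sum_def batch_def by (simp add: o_def del: n_lists.simps)
  also have "\<dots> = (\<Sum>z\<in>words B (Suc e). if fst (pt e z) \<le> fst q \<and> snd (pt e z) \<le> snd q then W z else 0)"
    using distinct_n_lists[of "[0..<B]" "Suc e"]
    by (subst sum_list_distinct_conv_sum_set) (auto simp: set_n_lists_words simp del: n_lists.simps)
  finally show ?thesis by (simp add: sum.If_cases Int_def)
qed

lemma sum_powers_le: "B \<ge> 2 \<Longrightarrow> (\<Sum>i<e. B ^ Suc i) \<le> 2 * B ^ e"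
proof (induction e)
  case (Suc e)
  then have "(\<Sum>i<Suc e. B ^ Suc i) \<le> 2 * B ^ e + B ^ Suc e" by simp
  also have "\<dots> \<le> B * B ^ e + B ^ Suc e" using Suc.prems by (intro add_right_mono mult_right_mono) auto
  finally show ?case by simp
qed simp

text \<open>Both numbers are compared in blocks of length B^l * s * B, one for each value of the
  prefix. Lower digits, offset and residue stay inside a block, so the prefixes decide unless they
  are equal.\<close>

lemma prefix_dominance:
  fixes a a' r1 r2 off s r l :: nat
  assumes "off < s" "r < s * B" "r1 < B ^ l * B" "r2 < B ^ l"
  shows "a' < a \<Longrightarrow> (a' * (B ^ l * B) + r1) * s + off \<le> (a * B ^ l + r2) * (s * B) + r"
    and "(a' * (B ^ l * B) + r1) * s + off \<le> (a * B ^ l + r2) * (s * B) + r \<Longrightarrow> a' \<le> a"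
proof -
  assume "a' < a"
  have "(a' * (B ^ l * B) + r1) * s + off \<le> (a' * (B ^ l * B) + r1 + 1) * s" using assms(1) by simp
  also have "\<dots> \<le> (a' * (B ^ l * B) + B ^ l * B) * s" using assms(3) by (intro mult_right_mono) auto
  also have "\<dots> = Suc a' * (B ^ l * (s * B))" by (simp add: algebra_simps)
  also have "\<dots> \<le> a * (B ^ l * (s * B))" using \<open>a' < a\<close> by (intro mult_right_mono) auto
  finally show "(a' * (B ^ l * B) + r1) * s + off \<le> (a * B ^ l + r2) * (s * B) + r"
    by (simp add: algebra_simps)
next
  assume *: "(a' * (B ^ l * B) + r1) * s + off \<le> (a * B ^ l + r2) * (s * B) + r"
  have "a' * (B ^ l * (s * B)) \<le> (a' * (B ^ l * B) + r1) * s + off" by (simp add: algebra_simps)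
  also note *
  also have "(a * B ^ l + r2) * (s * B) + r < (a * B ^ l + r2 + 1) * (s * B)" using assms(2) by simp
  also have "\<dots> \<le> (a * B ^ l + B ^ l) * (s * B)" using assms(4) by (intro mult_right_mono) auto
  also have "\<dots> = Suc a * (B ^ l * (s * B))" by (simp add: algebra_simps)
  finally have "a' < Suc a" by (simp only: mult_less_cancel2)
  then show "a' \<le> a" by simp
qed

lemma dominated_prefix:
  assumes j: "j < e" and z: "z \<in> words B (Suc e)" and v: "v \<in> words B e" and x: "x \<in> words B e"
    and e: "e < side e" and r: "rx < side e * B" "ry < side e * B"
  shows "val B (take (Suc j) z) < val B (take (Suc j) x) \<Longrightarrow>
      val B (rev (drop (Suc j) z)) < val B (rev (drop j v)) \<Longrightarrow> dominated rx ry e z (v, x)"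
    and "dominated rx ry e z (v, x) \<Longrightarrow> val B (take (Suc j) z) \<le> val B (take (Suc j) x) \<and>
      val B (rev (drop (Suc j) z)) \<le> val B (rev (drop j v))"
proof -
  define r1 r2 t1 t2 where "r1 = val B (drop (Suc j) z)" and "r2 = val B (drop (Suc j) x)"
    and "t1 = val B (rev (take (Suc j) z))" and "t2 = val B (rev (take j v))"
  have len: "length z = Suc e" "length x = e" "length v = e" using z v x by (auto dest: length_words)
  define l where "l = e - Suc j"
  have el: "e - j = Suc l" using j by (simp add: l_def)
  have zx: "val B z = val B (take (Suc j) z) * (B ^ l * B) + r1"
    using val_append[of B "take (Suc j) z" "drop (Suc j) z"] len j by (simp add: r1_def el mult.commute)
  have xx: "val B x = val B (take (Suc j) x) * B ^ l + r2"
    using val_append[of B "take (Suc j) x" "drop (Suc j) x"] len j by (simp add: r2_def l_def)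
  have r1: "r1 < B ^ l * B"
    using val_less[OF drop_words[OF z, of "Suc j"]] by (simp add: r1_def el mult.commute)
  have r2: "r2 < B ^ l"
    using val_less[OF drop_words[OF x, of "Suc j"]] by (simp add: r2_def l_def)
  have X: "val B (take (Suc j) z) < val B (take (Suc j) x) \<Longrightarrow> val B z * side e + e \<le> val B x * (side e * B) + rx"
    "val B z * side e + e \<le> val B x * (side e * B) + rx \<Longrightarrow> val B (take (Suc j) z) \<le> val B (take (Suc j) x)"
    unfolding zx xx by (rule prefix_dominance[OF e r(1) r1 r2], assumption)+
  have "rev z = rev (drop (Suc j) z) @ rev (take (Suc j) z)" by (metis append_take_drop_id rev_append)
  then have zy: "val B (rev z) = val B (rev (drop (Suc j) z)) * (B ^ j * B) + t1"
    using val_append[of B "rev (drop (Suc j) z)" "rev (take (Suc j) z)"] len j by (simp add: t1_def mult.commute)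
  have "rev v = rev (drop j v) @ rev (take j v)" by (metis append_take_drop_id rev_append)
  then have vy: "val B (rev v) = val B (rev (drop j v)) * B ^ j + t2"
    using val_append[of B "rev (drop j v)" "rev (take j v)"] len j by (simp add: t2_def)
  have t1: "t1 < B ^ j * B"
    using val_less[of "rev (take (Suc j) z)" B "Suc j"] take_words[OF z, of "Suc j"] j by (simp add: t1_def mult.commute)
  have t2: "t2 < B ^ j"
    using val_less[of "rev (take j v)" B j] take_words[OF v, of j] j by (simp add: t2_def)
  have pos: "0 < side e" using e by simp
  \<comment> \<open>For y-coordinates the lower part of the query has j digits and the point has no
    offset, so the same lemma applies with l = j.\<close>
  have Y: "val B (rev (drop (Suc j) z)) < val B (rev (drop j v)) \<Longrightarrow> val B (rev z) * side e \<le> val B (rev v) * (side e * B) + ry"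
    "val B (rev z) * side e \<le> val B (rev v) * (side e * B) + ry \<Longrightarrow> val B (rev (drop (Suc j) z)) \<le> val B (rev (drop j v))"
    unfolding zy vy by (rule prefix_dominance[OF pos r(2) t1 t2, unfolded add_0_right], assumption)+
  show "val B (take (Suc j) z) < val B (take (Suc j) x) \<Longrightarrow>
      val B (rev (drop (Suc j) z)) < val B (rev (drop j v)) \<Longrightarrow> dominated rx ry e z (v, x)"
    using X(1) Y(1) by (simp add: dominated_def pt_def)
  show "dominated rx ry e z (v, x) \<Longrightarrow> val B (take (Suc j) z) \<le> val B (take (Suc j) x) \<and>
      val B (rev (drop (Suc j) z)) \<le> val B (rev (drop j v))"
    using X(2) Y(2) by (simp add: dominated_def pt_def)
qed

end

section \<open>Averaging over weights, queries and epochs\<close>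

lemma sum_PiE_resample_ge:
  fixes f :: "('i \<Rightarrow> 'a) \<Rightarrow> real"
  assumes I: "finite I" "i \<in> I" and F: "\<And>j. j \<in> I \<Longrightarrow> finite (F j)" "F i \<noteq> {}"
    and le: "\<And>g. g \<in> PiE I F \<Longrightarrow> real (card (F i)) * c \<le> (\<Sum>y\<in>F i. f (g(i := y)))"
  shows "real (card (PiE I F)) * c \<le> (\<Sum>g\<in>PiE I F. f g)"
proof -
  have "real (card (F i)) * (real (card (PiE I F)) * c) = (\<Sum>g\<in>PiE I F. real (card (F i)) * c)" by simp
  also have "\<dots> \<le> (\<Sum>g\<in>PiE I F. \<Sum>y\<in>F i. f (g(i := y)))" by (intro sum_mono le)
  also have "\<dots> = (\<Sum>(g, y)\<in>PiE I F \<times> F i. f (g(i := y)))" by (simp add: sum.cartesian_product)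
  \<comment> \<open>Exchanging y with the i-th entry of g is an involution of the index set:
    redrawing one coordinate keeps the distribution uniform.\<close>
  also have "\<dots> = (\<Sum>(g, y)\<in>PiE I F \<times> F i. f g)"
    by (rule sum.reindex_bij_witness[where i = "\<lambda>(g, y). (g(i := y), g i)" and j = "\<lambda>(g, y). (g(i := y), g i)"])
       (use I in \<open>auto simp: PiE_iff extensional_def\<close>)
  also have "\<dots> = (\<Sum>g\<in>PiE I F. real (card (F i)) * f g)" by (simp flip: sum.cartesian_product)
  also have "\<dots> = real (card (F i)) * (\<Sum>g\<in>PiE I F. f g)" by (simp add: sum_distrib_left)
  finally show ?thesis using F I by (simp add: card_gt_0_iff)
qed

lemma sum_mult_split:
  "(\<Sum>X<k. \<Sum>r<s. f (X * s + r)) = (\<Sum>x<k * s. f (x::nat))"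
proof -
  have "(\<Sum>r<s. f (X * s + r)) = sum f {X * s..<X * s + s}" for X
    using sum.shift_bounds_nat_ivl[of f 0 "X * s" s] by (simp add: lessThan_atLeast0 add.commute)
  then show ?thesis by (simp add: sum.nat_group)
qed

lemma sum_words_val: "(\<Sum>x\<in>words B l. f (val B x)) = (\<Sum>X<B ^ l. f X)"
  by (rule sum.reindex_bij_betw[OF bij_val])

lemma sum_words_val_rev: "(\<Sum>x\<in>words B l. f (val B (rev x))) = (\<Sum>X<B ^ l. f X)"
proof -
  have "(\<Sum>x\<in>words B l. f (val B (rev x))) = (\<Sum>x\<in>words B l. f (val B x))"
    by (rule sum.reindex_bij_witness[where i = rev and j = rev]) auto
  then show ?thesis by (simp add: sum_words_val)
qed

text \<open>F pads the sequence to exactly n insertions, the length that \<open>query_time\<close>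
  asks for. It precedes all epochs and thus only affects what the decoder knows. The bound 16 \<tau>
  \<le> E leaves 8 \<tau> \<le> e for the upper half of the epochs.\<close>

locale hard_instance =
  fixes n w b B \<gamma> \<tau> \<rho> E :: nat and D :: range_ds and F :: "(point \<times> nat) list"
  assumes ds: "is_range_ds w n b D"
    and \<gamma>: "\<gamma> > 54" and B: "B = \<gamma> ^ 4"
    and upd: "1 \<le> update_time n b D" "update_time n b D \<le> B"
    and \<tau>: "1 \<le> \<tau>" "16 * \<tau> \<le> E" and \<rho>: "4 * \<rho> + 2 \<le> \<gamma>\<^sup>2"
    and small: "B ^ (4 * E) \<le> 2 ^ b"
    and budget: "6 + 4 * (w * (\<tau> + 2 * update_time n b D)) \<le> b * \<rho>"
    and room: "Suc E * B ^ Suc E \<le> n"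
    and F_grid: "set F \<subseteq> grid n \<times> {0..<2 ^ b}" and F_distinct: "distinct (map fst F)"
    and F_fresh: "\<And>e z. e \<le> E \<Longrightarrow> z \<in> words B (Suc e) \<Longrightarrow> pt n B E e z \<notin> fst ` set F"
    and F_length: "length F + (\<Sum>e<Suc E. B ^ Suc e) = n"
begin

definition weights :: "nat \<Rightarrow> (nat list \<Rightarrow> nat) set" where
  "weights e = (\<Pi>\<^sub>E z\<in>words B (Suc e). {..<2 ^ b})"

definition all_weights :: "(nat \<Rightarrow> nat list \<Rightarrow> nat) set" where
  "all_weights = (\<Pi>\<^sub>E e\<in>{..E}. weights e)"

definition earlier :: "nat \<Rightarrow> (nat \<Rightarrow> nat list \<Rightarrow> nat) \<Rightarrow> (point \<times> nat) list" where
  "earlier e Ws = F @ batches n B E Ws (Suc e) (Suc E)"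

definition updates :: "(nat \<Rightarrow> nat list \<Rightarrow> nat) \<Rightarrow> (point \<times> nat) list" where
  "updates Ws = F @ batches n B E Ws 0 (Suc E)"

definition mem :: "(nat \<Rightarrow> nat list \<Rightarrow> nat) \<Rightarrow> memory" where
  "mem Ws = memory_after D (updates Ws)"

definition later_cells :: "nat \<Rightarrow> (nat \<Rightarrow> nat list \<Rightarrow> nat) \<Rightarrow> nat set" where
  "later_cells e Ws = touched D (batches n B E Ws 0 e)
     (memory_after D (earlier e Ws @ batch n B E e (Ws e)))"

text \<open>Only cells not probed again in later epochs count, which makes these sets disjoint.\<close>

definition epoch_cells :: "nat \<Rightarrow> (nat \<Rightarrow> nat list \<Rightarrow> nat) \<Rightarrow> nat set" where
  "epoch_cells e Ws = touched D (batch n B E e (Ws e)) (memory_after D (earlier e Ws)) - later_cells e Ws"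

lemma B2: "B \<ge> 2"
  using \<gamma> power_increasing[of 1 4 \<gamma>] unfolding B by simp

lemma side_gt: "e \<le> E \<Longrightarrow> E < side n B E e"
proof -
  assume "e \<le> E"
  have "Suc E \<le> n div B ^ Suc E"
    using room B2 by (simp add: less_eq_div_iff_mult_less_eq del: power_Suc)
  also have "\<dots> \<le> side n B E e" using B2 by (simp add: side_def)
  finally show ?thesis by simp
qed

lemma side_mult: "e \<le> E \<Longrightarrow> B ^ e * (side n B E e * B) = n div B ^ Suc E * B ^ Suc E"
  by (simp add: side_def mult.commute mult.left_commute flip: power_add)

lemma side_mult_le: "e \<le> E \<Longrightarrow> B ^ e * (side n B E e * B) \<le> n"
  by (simp add: side_mult del: power_Suc)

lemma coord_less:
  assumes "X < B ^ Suc e" "e \<le> E" "off \<le> e"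
  shows "X * side n B E e + off < n"
proof -
  have "X * side n B E e + off < Suc X * side n B E e" using side_gt[OF assms(2)] assms by simp
  also have "\<dots> \<le> B ^ Suc e * side n B E e" using assms(1) by (intro mult_right_mono) auto
  also have "\<dots> \<le> n" using side_mult_le[OF assms(2)] by (simp add: mult_ac)
  finally show ?thesis .
qed

lemma pt_grid: "e \<le> E \<Longrightarrow> z \<in> words B (Suc e) \<Longrightarrow> pt n B E e z \<in> grid n"
  using coord_less[of "val B z" e e] coord_less[of "val B (rev z)" e 0] val_less[of z B "Suc e"] val_less[of "rev z" B "Suc e"]
  by (simp add: pt_def grid_def del: power_Suc)

lemma pt_inj:
  assumes "e \<le> E" "e' \<le> E" "z \<in> words B (Suc e)" "z' \<in> words B (Suc e')" "pt n B E e z = pt n B E e' z'"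
  shows "e = e' \<and> z = z'"
proof -
  define g where "g = n div B ^ Suc E"
  have g: "E < g" using side_gt[of E] by (simp add: side_def g_def)
  have mod: "fst (pt n B E i y) mod g = i" if "i \<le> E" for i y
  proof -
    have "fst (pt n B E i y) = i + g * (B ^ (E - i) * val B y)"
      by (simp add: pt_def side_def g_def mult_ac)
    then show ?thesis using that g by simp
  qed
  have "e = e'" using mod[OF assms(1), of z] mod[OF assms(2), of z'] assms(5) by simp
  moreover have "val B z = val B z'" using assms(5) \<open>e = e'\<close> side_gt[OF assms(1)] by (simp add: pt_def)
  ultimately show ?thesis using inj_onD[OF inj_val] assms(3,4) by blast
qed

lemma updates_split:
  "e \<le> E \<Longrightarrow> updates Ws = earlier e Ws @ batch n B E e (Ws e) @ batches n B E Ws 0 e"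
  using batches_split[of 0 e "Suc E" n B E Ws] by (simp add: updates_def earlier_def)

lemma set_batches: "set (batches n B E Ws l h) = (\<Union>e\<in>{l..<h}. (\<lambda>z. (pt n B E e z, Ws e z)) ` words B (Suc e))"
  by (auto simp: batches_def batch_def set_n_lists_words simp del: n_lists.simps)

lemma distinct_batches: "h \<le> Suc E \<Longrightarrow> distinct (map fst (batches n B E Ws 0 h))"
proof (induction h)
  case (Suc h)
  have "distinct (map (pt n B E h) (List.n_lists (Suc h) [0..<B]))"
    using Suc.prems pt_inj[of h h]
    by (auto simp: distinct_map set_n_lists_words intro!: inj_onI distinct_n_lists simp del: n_lists.simps)
  moreover have "fst ` set (batch n B E h (Ws h)) \<inter> fst ` set (batches n B E Ws 0 h) = {}"
  proof (rule equals0I)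
    fix p assume "p \<in> fst ` set (batch n B E h (Ws h)) \<inter> fst ` set (batches n B E Ws 0 h)"
    then obtain z e y where "z \<in> words B (Suc h)" "e < h" "y \<in> words B (Suc e)"
        "pt n B E h z = pt n B E e y"
      by (auto simp: set_batches batch_def set_n_lists_words simp del: n_lists.simps)
    then show False using pt_inj[of h e z y] Suc.prems by auto
  qed
  ultimately show ?case using Suc
    by (simp add: batches_split[of 0 h "Suc h"] batches_def[of n B E Ws "Suc h" "Suc h"] batch_def o_def image_image del: n_lists.simps)
qed (simp add: batches_def)

lemma updates_insertions:
  assumes "Ws \<in> all_weights"
  shows "updates Ws \<in> insertions n b" "length (updates Ws) = n"
proof -
  show len: "length (updates Ws) = n"
    using F_length by (simp add: updates_def length_batches lessThan_atLeast0)
  have "p \<notin> fst ` set F" if "p \<in> fst ` set (batches n B E Ws 0 (Suc E))" for p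
  proof -
    from that obtain e z where "p = pt n B E e z" "e \<le> E" "z \<in> words B (Suc e)"
      by (auto simp: set_batches less_Suc_eq_le)
    then show ?thesis using F_fresh by simp
  qed
  then have "fst ` set F \<inter> fst ` set (batches n B E Ws 0 (Suc E)) = {}" by blast
  then have "distinct (map fst (updates Ws))"
    using F_distinct distinct_batches[of "Suc E" Ws] by (simp add: updates_def)
  moreover have "set (batches n B E Ws 0 (Suc E)) \<subseteq> grid n \<times> {0..<2 ^ b}"
    using assms pt_grid by (fastforce simp: set_batches all_weights_def weights_def)
  ultimately show "updates Ws \<in> insertions n b"
    using len F_grid by (simp add: insertions_def updates_def)
qed

lemma finite_weights [simp]: "finite (weights e)"
  unfolding weights_def by (intro finite_PiE) auto

lemma weights_nonempty [simp]: "weights e \<noteq> {}"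
  unfolding weights_def by (simp add: PiE_eq_empty_iff lessThan_empty_iff)

lemma finite_all_weights [simp]: "finite all_weights"
  unfolding all_weights_def by (intro finite_PiE) auto

lemma all_weights_upd: "Ws \<in> all_weights \<Longrightarrow> W \<in> weights e \<Longrightarrow> e \<le> E \<Longrightarrow> Ws(e := W) \<in> all_weights"
  unfolding all_weights_def by (auto simp: PiE_iff extensional_def)

text \<open>Smaller indices come later, so whatever epoch e touches counts among the later cells of
  e' and has been removed there.\<close>

lemma epoch_cells_disjoint:
  assumes "e < e'" "e' \<le> E"
  shows "epoch_cells e Ws \<inter> epoch_cells e' Ws = {}"
proof -
  have "batches n B E Ws 0 e' = batches n B E Ws (Suc e) e' @ batch n B E e (Ws e) @ batches n B E Ws 0 e"
    using assms by (intro batches_split) auto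
  moreover have "earlier e Ws = (earlier e' Ws @ batch n B E e' (Ws e')) @ batches n B E Ws (Suc e) e'"
    using assms batches_split[of "Suc e" e' "Suc E" n B E Ws] by (simp add: earlier_def)
  moreover have touched_append: "touched D (U @ V) m = touched D U m \<union> touched D V (exec D U m)" for U V m
    by (induction U arbitrary: m) (auto simp: split_def)
  ultimately have "touched D (batch n B E e (Ws e)) (memory_after D (earlier e Ws)) \<subseteq> later_cells e' Ws"
    unfolding later_cells_def by (simp add: memory_after_append) blast
  then show ?thesis by (auto simp: epoch_cells_def)
qed

context
  fixes P :: "point \<Rightarrow> nat cell_prog"
  assumes P: "\<And>q. q \<in> grid n \<Longrightarrow> P q \<in> set_pmf (query_prog D q)"
begin

text \<open>The weights of all other epochs and the residues are frozen, which is the setting of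
  \<open>epoch_probes_ge\<close>. The later insertions then do not depend on W, although the cells
  they touch may.\<close>

lemma epoch_ge:
  assumes Ws: "Ws \<in> all_weights" and e: "e \<le> E" "E \<le> 2 * e"
    and r: "rx < side n B E e * B" "ry < side n B E e * B"
  shows "real (card (weights e)) * (real (B ^ e) ^ 2 * real \<tau> / 4) \<le>
    (\<Sum>W\<in>weights e. \<Sum>(v, x)\<in>words B e \<times> words B e.
      real (card (probed_cells (P (val B x * (side n B E e * B) + rx, val B (rev v) * (side n B E e * B) + ry))
        (mem (Ws(e := W))) \<inter> epoch_cells e (Ws(e := W)))))"
proof -
  define qp where "qp = (\<lambda>(v, x). (val B x * (side n B E e * B) + rx, val B (rev v) * (side n B E e * B) + ry))"
  define M where "M W = mem (Ws(e := W))" for W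
  have qp_grid: "qp q \<in> grid n" if "q \<in> words B e \<times> words B e" for q
  proof -
    have *: "X * (side n B E e * B) + r < n" if "X < B ^ e" "r < side n B E e * B" for X r
    proof -
      have "X * (side n B E e * B) + r < Suc X * (side n B E e * B)" using that by simp
      also have "\<dots> \<le> B ^ e * (side n B E e * B)" using that by (intro mult_right_mono) auto
      finally show ?thesis using side_mult_le[OF e(1)] by simp
    qed
    obtain v x where q: "q = (v, x)" by (cases q)
    with that show ?thesis using *[of "val B x" rx] *[of "val B (rev v)" ry] r
        val_less[of x B e] val_less[of "rev v" B e] by (simp add: qp_def grid_def)
  qed
  have eq: "earlier e (Ws(e := W)) = earlier e Ws" "batches n B E (Ws(e := W)) 0 e = batches n B E Ws 0 e" for W
    unfolding earlier_def by (auto intro!: batches_cong)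
  have split: "updates (Ws(e := W)) = (earlier e Ws @ batch n B E e W) @ batches n B E Ws 0 e" for W
    using updates_split[OF e(1), of "Ws(e := W)"] eq by simp
  have ins: "(earlier e Ws @ batch n B E e W) @ batches n B E Ws 0 e \<in> insertions n b" if "W \<in> weights e" for W
    using updates_insertions(1)[OF all_weights_upd[OF Ws that e(1)]] split by simp
  have ins': "earlier e Ws @ batch n B E e W \<in> insertions n b" if "W \<in> weights e" for W
    using ins[OF that] by (rule insertions_prefix)
  have ins'': "earlier e Ws \<in> insertions n b" if "W \<in> weights e" for W
    using ins'[OF that] by (rule insertions_prefix)
  have later: "later_cells e (Ws(e := W)) = touched D (batches n B E Ws 0 e)
      (memory_after D (earlier e Ws @ batch n B E e W))" for W
    by (simp add: later_cells_def eq)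
  have cells: "epoch_cells e (Ws(e := W)) = touched D (batch n B E e W) (memory_after D (earlier e Ws)) -
      later_cells e (Ws(e := W))" for W
    by (simp add: epoch_cells_def eq)
  have "real (card (\<Pi>\<^sub>E z\<in>words B (Suc e). {..<2 ^ b :: nat})) * (real (B ^ e) ^ 2 * real \<tau> / 4) \<le>
    (\<Sum>W\<in>(\<Pi>\<^sub>E z\<in>words B (Suc e). {..<2 ^ b :: nat}). \<Sum>q\<in>words B e \<times> words B e.
      real (card (probed_cells (P (qp q)) (M W) \<inter> epoch_cells e (Ws(e := W)))))"
  proof (rule epoch_probes_ge[OF \<gamma> B upd \<tau>(1) _ \<rho> _ budget, where D = "dominated n B E rx ry e"
        and L = "\<lambda>W. later_cells e (Ws(e := W))" and ?M0.0 = "memory_after D (earlier e Ws)"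
        and base = "\<lambda>q. range_sum (earlier e Ws) (qp q) + range_sum (batches n B E Ws 0 e) (qp q)"],
      fold weights_def)
    show "8 * \<tau> \<le> e" using \<tau> e by simp
    have "B ^ (4 * e) \<le> B ^ (4 * E)" using e B2 by (intro power_increasing) auto
    with small show "B ^ (4 * e) \<le> 2 ^ b" by simp
  next
    fix W assume W: "W \<in> weights e"
    have "touched D (batch n B E e W) (memory_after D (earlier e Ws)) \<subseteq> {..<2 ^ w}"
      using exec_fits[OF ds, of "batch n B E e W" "memory_after D (earlier e Ws)"]
        memory_after_fits[OF ds ins''[OF W]] ins'[OF W] by (auto simp: insertions_def)
    moreover have "card (touched D (batch n B E e W) (memory_after D (earlier e Ws))) \<le> B ^ e * B * update_time n b D"
      using card_touched_le[OF ins'[OF W]] by (simp add: mult_ac)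
    moreover have "card (epoch_cells e (Ws(e := W))) \<le> card (touched D (batch n B E e W) (memory_after D (earlier e Ws)))"
      unfolding cells by (intro card_mono) auto
    ultimately show "finite (epoch_cells e (Ws(e := W))) \<and>
        card (epoch_cells e (Ws(e := W))) \<le> B ^ e * B * update_time n b D \<and> epoch_cells e (Ws(e := W)) \<subseteq> {..<2 ^ w}"
      unfolding cells by auto
    have "touched D (batches n B E Ws 0 e) (memory_after D (earlier e Ws @ batch n B E e W)) \<subseteq> {..<2 ^ w}"
      using exec_fits[OF ds, of "batches n B E Ws 0 e" "memory_after D (earlier e Ws @ batch n B E e W)"]
        memory_after_fits[OF ds ins'[OF W]] ins[OF W] by (auto simp: insertions_def)
    moreover have "card (later_cells e (Ws(e := W))) \<le> 2 * B ^ e * update_time n b D"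
    proof -
      have "card (later_cells e (Ws(e := W))) \<le> length (batches n B E Ws 0 e) * update_time n b D"
        unfolding later by (rule card_touched_le[OF ins[OF W]])
      also have "\<dots> \<le> 2 * B ^ e * update_time n b D"
        using sum_powers_le[OF B2, of e] by (intro mult_right_mono) (auto simp: length_batches lessThan_atLeast0)
      finally show ?thesis .
    qed
    ultimately show "finite (later_cells e (Ws(e := W))) \<and>
        card (later_cells e (Ws(e := W))) \<le> 2 * B ^ e * update_time n b D \<and> later_cells e (Ws(e := W)) \<subseteq> {..<2 ^ w}"
      unfolding later by auto
    fix a
    show "M W a < 2 ^ w"
      unfolding M_def mem_def split by (rule memory_after_fits[OF ds ins[OF W]])
    assume a: "a \<notin> epoch_cells e (Ws(e := W))" "a \<notin> later_cells e (Ws(e := W))"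
    then have "a \<notin> touched D (batch n B E e W) (memory_after D (earlier e Ws))" by (simp add: cells)
    moreover have "M W a = memory_after D (earlier e Ws @ batch n B E e W) a"
      unfolding M_def mem_def split
      using a(2) exec_untouched[of a D "batches n B E Ws 0 e"] by (simp only: memory_after_append[of D "_ @ _"] later)
    ultimately show "M W a = memory_after D (earlier e Ws) a"
      by (simp add: memory_after_append exec_untouched)
  next
    fix W q assume W: "W \<in> weights e" and q: "q \<in> words B e \<times> words B e"
    have "result (P (qp q)) (M W) = range_sum (updates (Ws(e := W))) (qp q)"
      using ds P[OF qp_grid[OF q]] qp_grid[OF q] ins[OF W]
      unfolding is_range_ds_def M_def mem_def split by blast
    also have "\<dots> = range_sum (earlier e Ws) (qp q) + range_sum (batches n B E Ws 0 e) (qp q) +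
        (\<Sum>z\<in>{z \<in> words B (Suc e). dominated n B E rx ry e z q}. W z)"
      unfolding split by (simp add: range_sum_append range_sum_batch dominated_def qp_def split_def)
    finally show "result (P (qp q)) (M W) = range_sum (earlier e Ws) (qp q) + range_sum (batches n B E Ws 0 e) (qp q) +
        (\<Sum>z\<in>{z \<in> words B (Suc e). dominated n B E rx ry e z q}. W z)" .
  next
    have es: "e < side n B E e" using side_gt[OF e(1)] e by simp
    fix j z v x
    assume *: "j < e" "z \<in> words B (Suc e)" "v \<in> words B e" "x \<in> words B e"
    show "val B (take (Suc j) z) < val B (take (Suc j) x) \<Longrightarrow>
      val B (rev (drop (Suc j) z)) < val B (rev (drop j v)) \<Longrightarrow> dominated n B E rx ry e z (v, x)"
      by (rule dominated_prefix(1)[OF * es r])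
    show "dominated n B E rx ry e z (v, x) \<Longrightarrow> val B (take (Suc j) z) \<le> val B (take (Suc j) x) \<and>
      val B (rev (drop (Suc j) z)) \<le> val B (rev (drop j v))"
      by (rule dominated_prefix(2)[OF * es r])
  qed
  then show ?thesis by (simp add: M_def qp_def split_def weights_def)
qed

text \<open>Division with remainder by \<open>side e * B\<close> splits a coordinate into a word and
  a residue, so summing \<open>epoch_ge\<close> over all residues reaches every query of the N by N
  square. Redrawing the weights of epoch e removes the conditioning.\<close>

lemma epoch_total_ge:
  assumes e: "e \<le> E" "E \<le> 2 * e"
  defines "N \<equiv> n div B ^ Suc E * B ^ Suc E"
  shows "real (card all_weights) * (real N ^ 2 * real \<tau> / 4) \<le>
    (\<Sum>Ws\<in>all_weights. \<Sum>(x, y)\<in>{..<N} \<times> {..<N}.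
      real (card (probed_cells (P (x, y)) (mem Ws) \<inter> epoch_cells e Ws)))"
  unfolding all_weights_def
proof (rule sum_PiE_resample_ge[where i = e])
  fix Ws assume "Ws \<in> (\<Pi>\<^sub>E e\<in>{..E}. weights e)"
  then have Ws: "Ws \<in> all_weights" by (simp add: all_weights_def)
  define s where "s = side n B E e * B"
  have N: "N = B ^ e * s" unfolding N_def s_def by (rule side_mult[OF e(1), symmetric])
  define h where "h W x y = real (card (probed_cells (P (x, y)) (mem (Ws(e := W))) \<inter> epoch_cells e (Ws(e := W))))" for W x y
  have "real (card (weights e)) * (real N ^ 2 * real \<tau> / 4) =
      (\<Sum>rx<s. \<Sum>ry<s. real (card (weights e)) * (real (B ^ e) ^ 2 * real \<tau> / 4))"
    by (simp add: N power2_eq_square)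
  also have "\<dots> \<le> (\<Sum>rx<s. \<Sum>ry<s. \<Sum>W\<in>weights e. \<Sum>(v, x)\<in>words B e \<times> words B e.
      h W (val B x * s + rx) (val B (rev v) * s + ry))"
    unfolding h_def s_def by (intro sum_mono epoch_ge[OF Ws e]) auto
  also have "\<dots> = (\<Sum>W\<in>weights e. \<Sum>rx<s. \<Sum>ry<s. \<Sum>(v, x)\<in>words B e \<times> words B e.
      h W (val B x * s + rx) (val B (rev v) * s + ry))"
    by (subst (2) sum.swap, subst sum.swap) (rule refl)
  also have "\<dots> = (\<Sum>W\<in>weights e. \<Sum>(x, y)\<in>{..<N} \<times> {..<N}. h W x y)"
  proof (rule sum.cong[OF refl])
    fix W
    define G where "G x = (\<Sum>y<N. h W x y)" for x
    have "(\<Sum>(v, x)\<in>words B e \<times> words B e. h W (val B x * s + rx) (val B (rev v) * s + ry)) =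
        (\<Sum>X<B ^ e. \<Sum>Y<B ^ e. h W (X * s + rx) (Y * s + ry))" for rx ry
    proof -
      have "(\<Sum>(v, x)\<in>words B e \<times> words B e. h W (val B x * s + rx) (val B (rev v) * s + ry)) =
          (\<Sum>v\<in>words B e. \<Sum>x\<in>words B e. h W (val B x * s + rx) (val B (rev v) * s + ry))"
        by (simp add: sum.cartesian_product)
      also have "\<dots> = (\<Sum>v\<in>words B e. \<Sum>X<B ^ e. h W (X * s + rx) (val B (rev v) * s + ry))"
        by (intro sum.cong refl sum_words_val)
      also have "\<dots> = (\<Sum>Y<B ^ e. \<Sum>X<B ^ e. h W (X * s + rx) (Y * s + ry))"
        by (rule sum_words_val_rev)
      also have "\<dots> = (\<Sum>X<B ^ e. \<Sum>Y<B ^ e. h W (X * s + rx) (Y * s + ry))"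
        by (rule sum.swap)
      finally show ?thesis .
    qed
    then have "(\<Sum>rx<s. \<Sum>ry<s. \<Sum>(v, x)\<in>words B e \<times> words B e. h W (val B x * s + rx) (val B (rev v) * s + ry)) =
        (\<Sum>rx<s. \<Sum>ry<s. \<Sum>X<B ^ e. \<Sum>Y<B ^ e. h W (X * s + rx) (Y * s + ry))"
      by simp
    also have "\<dots> = (\<Sum>rx<s. \<Sum>X<B ^ e. \<Sum>ry<s. \<Sum>Y<B ^ e. h W (X * s + rx) (Y * s + ry))"
      by (intro sum.cong refl sum.swap)
    also have "\<dots> = (\<Sum>rx<s. \<Sum>X<B ^ e. G (X * s + rx))"
    proof (intro sum.cong refl)
      fix X rx
      have "(\<Sum>ry<s. \<Sum>Y<B ^ e. h W (X * s + rx) (Y * s + ry)) = (\<Sum>Y<B ^ e. \<Sum>ry<s. h W (X * s + rx) (Y * s + ry))"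
        by (rule sum.swap)
      also have "\<dots> = G (X * s + rx)" unfolding G_def N by (rule sum_mult_split)
      finally show "(\<Sum>ry<s. \<Sum>Y<B ^ e. h W (X * s + rx) (Y * s + ry)) = G (X * s + rx)" .
    qed
    also have "\<dots> = (\<Sum>X<B ^ e. \<Sum>rx<s. G (X * s + rx))" by (rule sum.swap)
    also have "\<dots> = (\<Sum>x<N. G x)" unfolding N by (rule sum_mult_split)
    finally show "(\<Sum>rx<s. \<Sum>ry<s. \<Sum>(v, x)\<in>words B e \<times> words B e. h W (val B x * s + rx) (val B (rev v) * s + ry)) =
       (\<Sum>(x, y)\<in>{..<N} \<times> {..<N}. h W x y)" by (simp add: sum.cartesian_product G_def)
  qed
  finally show "real (card (weights e)) * (real N ^ 2 * real \<tau> / 4) \<le>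
      (\<Sum>W\<in>weights e. \<Sum>(x, y)\<in>{..<N} \<times> {..<N}.
        real (card (probed_cells (P (x, y)) (mem (Ws(e := W))) \<inter> epoch_cells e (Ws(e := W)))))"
    by (simp add: h_def)
qed (use e in auto)

lemma total_ge:
  "real (card all_weights) * (real n ^ 2 * (real E * real \<tau> / 32)) \<le>
    (\<Sum>Ws\<in>all_weights. \<Sum>q\<in>grid n. real (card (probed_cells (P q) (mem Ws))))"
proof -
  define N where "N = n div B ^ Suc E * B ^ Suc E"
  define S where "S = {e. e \<le> E \<and> E \<le> 2 * e}"
  have finS [simp]: "finite S" by (simp add: S_def)
  have "{E - E div 2..E} \<subseteq> S" by (auto simp: S_def)
  then have "card {E - E div 2..E} \<le> card S" by (rule card_mono[OF finS])
  then have "Suc (E div 2) \<le> card S" by simp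
  then have cardS: "real E / 2 \<le> real (card S)" by linarith
  have Nn: "N \<le> n" by (simp add: N_def del: power_Suc)
  \<comment> \<open>Since n is at least 2 m, rounding it down to a multiple of m loses less than
    half.\<close>
  define m where "m = B ^ Suc E"
  have "m > 0" using B2 by (simp add: m_def)
  then have "n mod m < m" by simp
  moreover have "N + n mod m = n" unfolding N_def m_def by (rule div_mult_mod_eq)
  moreover have "2 * m \<le> Suc E * m" using \<tau> by (intro mult_right_mono) auto
  then have "2 * m \<le> n" using room unfolding m_def by linarith
  ultimately have "n < 2 * N" by linarith
  then have "real n / 2 \<le> real N" by linarith
  then have N2: "real n ^ 2 / 4 \<le> real N ^ 2"
    using power_mono[of "real n / 2" "real N" 2] by (simp add: power_divide)
  \<comment> \<open>The constant 32 is 2 * 4 * 4: half of the epochs, a quarter of the queries, and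
    the 1/4 from each epoch.\<close>
  have "real (card all_weights) * (real n ^ 2 * (real E * real \<tau> / 32)) =
      (real E / 2) * (real (card all_weights) * ((real n ^ 2 / 4) * real \<tau> / 4))" by simp
  also have "\<dots> \<le> real (card S) * (real (card all_weights) * (real N ^ 2 * real \<tau> / 4))"
  proof (rule mult_mono[OF cardS])
    have "(real n ^ 2 / 4) * real \<tau> \<le> real N ^ 2 * real \<tau>" using N2 by (rule mult_right_mono) simp
    then show "real (card all_weights) * ((real n ^ 2 / 4) * real \<tau> / 4) \<le> real (card all_weights) * (real N ^ 2 * real \<tau> / 4)"
      by (intro mult_left_mono divide_right_mono) auto
  qed auto
  also have "\<dots> = (\<Sum>e\<in>S. real (card all_weights) * (real N ^ 2 * real \<tau> / 4))" by simp
  also have "\<dots> \<le> (\<Sum>e\<in>S. \<Sum>Ws\<in>all_weights. \<Sum>(x, y)\<in>{..<N} \<times> {..<N}.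
      real (card (probed_cells (P (x, y)) (mem Ws) \<inter> epoch_cells e Ws)))"
    unfolding N_def by (intro sum_mono epoch_total_ge) (auto simp: S_def)
  also have "\<dots> = (\<Sum>Ws\<in>all_weights. \<Sum>q\<in>{..<N} \<times> {..<N}. \<Sum>e\<in>S.
      real (card (probed_cells (P q) (mem Ws) \<inter> epoch_cells e Ws)))"
  proof -
    have "(\<Sum>e\<in>S. \<Sum>Ws\<in>all_weights. \<Sum>q\<in>{..<N} \<times> {..<N}. real (card (probed_cells (P q) (mem Ws) \<inter> epoch_cells e Ws))) =
        (\<Sum>Ws\<in>all_weights. \<Sum>e\<in>S. \<Sum>q\<in>{..<N} \<times> {..<N}. real (card (probed_cells (P q) (mem Ws) \<inter> epoch_cells e Ws)))"
      by (rule sum.swap)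
    also have "\<dots> = (\<Sum>Ws\<in>all_weights. \<Sum>q\<in>{..<N} \<times> {..<N}. \<Sum>e\<in>S. real (card (probed_cells (P q) (mem Ws) \<inter> epoch_cells e Ws)))"
      by (intro sum.cong refl sum.swap)
    finally show ?thesis by (simp add: split_def)
  qed
  also have "\<dots> \<le> (\<Sum>Ws\<in>all_weights. \<Sum>q\<in>{..<N} \<times> {..<N}. real (card (probed_cells (P q) (mem Ws))))"
  proof (intro sum_mono)
    fix Ws q
    have "(\<Sum>e\<in>S. card (probed_cells (P q) (mem Ws) \<inter> epoch_cells e Ws)) =
        card (\<Union>e\<in>S. probed_cells (P q) (mem Ws) \<inter> epoch_cells e Ws)"
    proof (rule card_UN_disjoint[symmetric])
      show "\<forall>i\<in>S. \<forall>j\<in>S. i \<noteq> j \<longrightarrow>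
          probed_cells (P q) (mem Ws) \<inter> epoch_cells i Ws \<inter> (probed_cells (P q) (mem Ws) \<inter> epoch_cells j Ws) = {}"
      proof (intro ballI impI)
        fix i j assume "i \<in> S" "j \<in> S" "i \<noteq> j"
        then show "probed_cells (P q) (mem Ws) \<inter> epoch_cells i Ws \<inter> (probed_cells (P q) (mem Ws) \<inter> epoch_cells j Ws) = {}"
          using epoch_cells_disjoint[of i j Ws] epoch_cells_disjoint[of j i Ws]
          by (cases i j rule: linorder_cases) (auto simp: S_def)
      qed
    qed auto
    also have "\<dots> \<le> card (probed_cells (P q) (mem Ws))" by (intro card_mono) auto
    finally show "(\<Sum>e\<in>S. real (card (probed_cells (P q) (mem Ws) \<inter> epoch_cells e Ws))) \<le> real (card (probed_cells (P q) (mem Ws)))"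
      by (simp flip: of_nat_sum)
  qed
  also have "\<dots> \<le> (\<Sum>Ws\<in>all_weights. \<Sum>q\<in>grid n. real (card (probed_cells (P q) (mem Ws))))"
    using Nn by (intro sum_mono sum_mono2) (auto simp: grid_def)
  finally show ?thesis .
qed

end

end

section \<open>Randomized queries\<close>

text \<open>A crude bound by the number of addresses, but uniform in the coins; it makes the costs
  integrable.\<close>

lemma probed_cells_bound:
  assumes "is_range_ds w n b D" "U \<in> insertions n b" "q \<in> grid n" "P \<in> set_pmf (query_prog D q)"
  shows "card (probed_cells P (memory_after D U)) \<le> 2 ^ w"
proof -
  have "fits w P" using assms(1,3,4) unfolding is_range_ds_def by blast
  then have "probed_cells P (memory_after D U) \<subseteq> {..<2 ^ w}"
    using memory_after_fits[OF assms(1,2)] by (rule fits_probed_cells)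
  from card_mono[OF _ this] show ?thesis by simp
qed

lemma integrable_probes:
  assumes "is_range_ds w n b D" "U \<in> insertions n b" "q \<in> grid n"
  shows "integrable (measure_pmf (query_prog D q)) (\<lambda>P. real (card (probed_cells P (memory_after D U))))"
proof (rule measure_pmf.integrable_const_bound[where B = "2 ^ w"])
  show "AE P in measure_pmf (query_prog D q). norm (real (card (probed_cells P (memory_after D U)))) \<le> 2 ^ w"
    using probed_cells_bound[OF assms] by (auto simp: AE_measure_pmf_iff numeral_power_le_of_nat_cancel_iff)
qed simp

text \<open>The computation runs through nonnegative integrals, where integration over a monadic
  bind unfolds freely. The facts \<open>int\<close> and \<open>G\<close> lead from expectations to
  these integrals and back.\<close>

lemma avg_query_cost_eq:
  assumes ds: "is_range_ds w n b D" and U: "U \<in> insertions n b" and n: "n \<ge> 1"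
  shows "real n ^ 2 * avg_query_cost n D U = (\<Sum>q\<in>grid n.
    measure_pmf.expectation (query_prog D q) (\<lambda>P. real (card (probed_cells P (memory_after D U)))))"
proof -
  define f where "f P = real (card (probed_cells P (memory_after D U)))" for P :: "nat cell_prog"
  define G where "G q = measure_pmf.expectation (query_prog D q) f" for q
  have ne: "grid n \<noteq> {}" and card: "card (grid n) = n ^ 2"
    using n by (auto simp: grid_def power2_eq_square)
  have set: "set_pmf (pmf_of_set (grid n) \<bind> query_prog D) = (\<Union>q\<in>grid n. set_pmf (query_prog D q))"
    using ne by (simp add: set_bind_pmf set_pmf_of_set)
  have int: "integrable (measure_pmf (pmf_of_set (grid n) \<bind> query_prog D)) f"
  proof (rule measure_pmf.integrable_const_bound[where B = "2 ^ w"])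
    show "AE P in measure_pmf (pmf_of_set (grid n) \<bind> query_prog D). norm (f P) \<le> 2 ^ w"
      unfolding AE_measure_pmf_iff set using probed_cells_bound[OF ds U] by (auto simp: f_def)
  qed simp
  have G: "(\<integral>\<^sup>+ P. ennreal (f P) \<partial>measure_pmf (query_prog D q)) = ennreal (G q)" if "q \<in> grid n" for q
    unfolding G_def using integrable_probes[OF ds U that] by (intro nn_integral_eq_integral) (auto simp: f_def)
  have G0: "G q \<ge> 0" for q unfolding G_def by (intro Bochner_Integration.integral_nonneg) (simp add: f_def)
  have "ennreal (avg_query_cost n D U) = (\<integral>\<^sup>+ P. ennreal (f P) \<partial>measure_pmf (pmf_of_set (grid n) \<bind> query_prog D))"
    unfolding avg_query_cost_def f_def[symmetric]
    by (intro nn_integral_eq_integral[symmetric] int) (auto simp: f_def)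
  also have "\<dots> = (\<integral>\<^sup>+ q. (\<integral>\<^sup>+ P. ennreal (f P) \<partial>measure_pmf (query_prog D q)) \<partial>measure_pmf (pmf_of_set (grid n)))"
    by simp
  also have "\<dots> = (\<Sum>q\<in>grid n. (\<integral>\<^sup>+ P. ennreal (f P) \<partial>measure_pmf (query_prog D q))) / real (card (grid n))"
    using ne by (subst nn_integral_pmf_of_set) (auto simp: ennreal_of_nat_eq_real_of_nat)
  also have "\<dots> = ennreal ((\<Sum>q\<in>grid n. G q) / real (card (grid n)))"
    using ne G0 n by (simp add: G sum_ennreal divide_ennreal sum_nonneg card)
  finally have "avg_query_cost n D U = (\<Sum>q\<in>grid n. G q) / real (card (grid n))"
    by (subst (asm) ennreal_inj) (auto simp: avg_query_cost_def sum_nonneg G0 intro!: Bochner_Integration.integral_nonneg)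
  then show ?thesis using n by (simp add: G_def f_def[abs_def] card)
qed

lemma avg_query_cost_le_query_time:
  "U \<in> insertions n b \<Longrightarrow> length U = n \<Longrightarrow> avg_query_cost n D U \<le> query_time n b D"
  unfolding query_time_def by (rule Max_ge) auto

lemma (in prob_space) obtain_le_expectation:
  assumes "integrable M (X :: 'a \<Rightarrow> real)" "AE x in M. x \<in> A"
  shows "\<exists>x\<in>A. X x \<le> expectation X"
proof (rule ccontr)
  assume "\<not> ?thesis"
  then have "AE x in M. X x > expectation X"
    by (intro eventually_mono[OF assms(2)]) (auto simp: not_le)
  then show False using expectation_greater[OF assms(1)] by blast
qed

text \<open>This covers the range where the claimed bound is below a constant. Without a probe the
  answer would be constant, but every query dominates the origin, which may be absent or carry
  weight 1.\<close>

lemma query_time_ge_1: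
  assumes ds: "is_range_ds w n b D" and n: "n \<ge> 1" and b: "b \<ge> 1"
  shows "query_time n b D \<ge> 1"
proof -
  define U where "U = map (\<lambda>i. ((i, 0::nat), 0::nat)) [0..<n]"
  have U: "U \<in> insertions n b" "length U = n"
    by (auto simp: U_def insertions_def grid_def distinct_map o_def intro!: inj_onI)
  have probes: "card (probed_cells P (memory_after D U)) \<ge> 1" if q: "q \<in> grid n" and P: "P \<in> set_pmf (query_prog D q)" for q P
  proof -
    have correct: "result P (memory_after D V) = range_sum V q" if "V \<in> insertions n b" for V
      using ds q P that unfolding is_range_ds_def by blast
    have "[((0, 0), 1)] \<in> insertions n b" "[] \<in> insertions n b"
      using n one_less_power[of "2::nat" b] b by (auto simp: insertions_def grid_def)
    from correct[OF this(1)] correct[OF this(2)]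
    have "P \<noteq> Return r" for r by (auto simp: range_sum_def)
    then have "probed_cells P (memory_after D U) \<noteq> {}" by (cases P) auto
    then show ?thesis by (simp add: Suc_le_eq card_gt_0_iff)
  qed
  have "(\<Sum>q\<in>grid n. 1) \<le> real n ^ 2 * avg_query_cost n D U"
    unfolding avg_query_cost_eq[OF ds U(1) n]
    using probes integrable_probes[OF ds U(1)]
    by (intro sum_mono measure_pmf.integral_ge_const) (auto simp: AE_measure_pmf_iff)
  then have "real n ^ 2 * 1 \<le> real n ^ 2 * avg_query_cost n D U"
    by (simp add: grid_def power2_eq_square)
  then have "1 \<le> avg_query_cost n D U" using n by (simp only: mult_le_cancel_left) auto
  then show ?thesis using avg_query_cost_le_query_time[OF U, of D] by simp
qed

context hard_instance
begin

text \<open>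
  The coins of each query are fixed to an outcome that is no worse than average over the hard
  distribution, so deterministic queries suffice.
\<close>

lemma query_time_ge: "real E * real \<tau> / 32 \<le> query_time n b D"
proof -
  have n: "n \<ge> 1" using room B2 by (metis One_nat_def Suc_leI le_trans mult_pos_pos not_gr_zero power_eq_0_iff zero_less_Suc not_numeral_le_zero)
  note ins = updates_insertions
  define h where "h P = (\<Sum>Ws\<in>all_weights. real (card (probed_cells P (mem Ws))))" for P :: "nat cell_prog"
  have int: "integrable (measure_pmf (query_prog D q)) (\<lambda>P. real (card (probed_cells P (mem Ws))))"
    if "q \<in> grid n" "Ws \<in> all_weights" for q Ws
    unfolding mem_def by (rule integrable_probes[OF ds ins(1)[OF that(2)] that(1)])
  have "\<exists>P\<in>set_pmf (query_prog D q). h P \<le> measure_pmf.expectation (query_prog D q) h" if "q \<in> grid n" for q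
    using int[OF that] unfolding h_def[abs_def]
    by (intro measure_pmf.obtain_le_expectation Bochner_Integration.integrable_sum) (auto simp: AE_measure_pmf_iff)
  then obtain P where P: "\<And>q. q \<in> grid n \<Longrightarrow> P q \<in> set_pmf (query_prog D q)"
    and le: "\<And>q. q \<in> grid n \<Longrightarrow> h (P q) \<le> measure_pmf.expectation (query_prog D q) h"
    by metis
  have "real (card all_weights) * (real n ^ 2 * (real E * real \<tau> / 32)) \<le>
      (\<Sum>Ws\<in>all_weights. \<Sum>q\<in>grid n. real (card (probed_cells (P q) (mem Ws))))"
    by (rule total_ge[OF P])
  also have "\<dots> = (\<Sum>q\<in>grid n. h (P q))" unfolding h_def by (rule sum.swap)
  also have "\<dots> \<le> (\<Sum>q\<in>grid n. measure_pmf.expectation (query_prog D q) h)" by (intro sum_mono le)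
  also have "\<dots> = (\<Sum>q\<in>grid n. \<Sum>Ws\<in>all_weights. measure_pmf.expectation (query_prog D q)
      (\<lambda>P. real (card (probed_cells P (mem Ws)))))"
    unfolding h_def using int by (intro sum.cong refl Bochner_Integration.integral_sum)
  also have "\<dots> = (\<Sum>Ws\<in>all_weights. \<Sum>q\<in>grid n. measure_pmf.expectation (query_prog D q)
      (\<lambda>P. real (card (probed_cells P (mem Ws)))))" by (rule sum.swap)
  also have "\<dots> = (\<Sum>Ws\<in>all_weights. real n ^ 2 * avg_query_cost n D (updates Ws))"
    unfolding mem_def using avg_query_cost_eq[OF ds ins(1) n] by (intro sum.cong refl) simp
  also have "\<dots> \<le> (\<Sum>Ws\<in>all_weights. real n ^ 2 * query_time n b D)"
    using ins by (intro sum_mono mult_left_mono avg_query_cost_le_query_time) auto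
  finally have "(real (card all_weights) * real n ^ 2) * (real E * real \<tau> / 32) \<le>
      (real (card all_weights) * real n ^ 2) * query_time n b D" by (simp add: mult.assoc)
  moreover have "all_weights \<noteq> {}" unfolding all_weights_def by (simp add: PiE_eq_empty_iff)
  then have "real (card all_weights) * real n ^ 2 > 0"
    using n by (simp add: card_gt_0_iff)
  ultimately show ?thesis by (simp only: mult_le_cancel_left_pos)
qed

end

section \<open>Choice of the parameters\<close>

lemma filler_exists:
  assumes "(\<Sum>e<Suc E. B ^ Suc e) \<le> n"
  shows "\<exists>F. set F \<subseteq> grid n \<times> {0..<2 ^ b :: nat} \<and> distinct (map fst F) \<and>
    (\<forall>e\<le>E. \<forall>z\<in>words B (Suc e). pt n B E e z \<notin> fst ` set F) \<and>
    length F + (\<Sum>e<Suc E. B ^ Suc e) = n"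
proof -
  define T where "T = (\<Sum>e<Suc E. B ^ Suc e)"
  define X where "X = (\<Union>e\<in>{..<Suc E}. pt n B E e ` words B (Suc e))"
  have "card X \<le> (\<Sum>e<Suc E. card (pt n B E e ` words B (Suc e)))"
    unfolding X_def by (rule card_UN_le) simp
  also have "\<dots> \<le> T" unfolding T_def
    by (intro sum_mono) (metis card_image_le card_words finite_words)
  finally have "n ^ 2 - T \<le> card (grid n) - card X" by (simp add: grid_def power2_eq_square)
  also have "\<dots> \<le> card (grid n - X)" by (rule diff_card_le_card_Diff) (simp add: X_def)
  \<comment> \<open>The grid has n^2 \<ge> n points, and the epochs occupy at most T of
    them.\<close>
  finally have "n - T \<le> card (grid n - X)"
    using self_le_power[of n 2] by (cases "n = 0") (auto intro: order_trans[OF diff_le_mono])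
  then obtain Y where Y: "Y \<subseteq> grid n - X" "card Y = n - T" by (meson obtain_subset_with_card_n)
  then have "finite Y" using finite_subset finite_grid by blast
  then obtain ys where ys: "set ys = Y" "distinct ys" using finite_distinct_list by blast
  have "length ys = n - T" using ys Y distinct_card by metis
  moreover have "pt n B E e z \<notin> set ys" if "e \<le> E" "z \<in> words B (Suc e)" for e z
  proof -
    have "pt n B E e z \<in> X" unfolding X_def using that by (intro UN_I[of e] imageI) auto
    then show ?thesis using Y ys by blast
  qed
  ultimately show ?thesis
    using ys Y assms unfolding T_def[symmetric]
    by (intro exI[of _ "map (\<lambda>p. (p, 0)) ys"]) (auto simp: o_def image_image)
qed

lemma power_le_two_power:
  assumes "x \<ge> 1" "real m * log 2 (real x) \<le> real k"
  shows "x ^ m \<le> 2 ^ k"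
proof -
  have "log 2 (real (x ^ m)) = real m * log 2 (real x)"
    using assms(1) by (simp add: log_nat_power)
  then have "real (x ^ m) \<le> 2 powr real k"
    using assms by (subst le_powr_iff) auto
  also have "\<dots> = real (2 ^ k)" by (simp add: powr_realpow)
  finally show ?thesis by (simp only: of_nat_le_iff)
qed

text \<open>With s = w * u the parameters are \<rho> = s^3, \<gamma> = s^2 and B = s^8. The number
  \<rho> has to exceed w (\<tau> + 2 u) = O(s^2) including its constant, which
  \<open>14 + 4 / c\<^sub>w\<close> supplies through the bound on w, and 4 \<rho> + 2 \<le>
  \<gamma>^2 = s^4 takes one more power. Of the bounds on \<kappa>, 1 / 32 keeps the epochs inside
  the grid and \<open>c\<^sub>1 / 32\<close> makes weights long enough to pay for the names of the
  queries.\<close>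

lemma query_time_ge_square:
  fixes c\<^sub>w c\<^sub>1 \<kappa> r :: real
  assumes pos: "c\<^sub>w > 0" and \<kappa>: "\<kappa> > 0" "\<kappa> \<le> 1 / 32" "\<kappa> \<le> c\<^sub>1 / 32"
    and ds: "is_range_ds w n b D" and n: "n \<ge> 1" and b: "b \<ge> 1" "c\<^sub>1 * log 2 (real n) \<le> real b"
    and w: "real w \<ge> c\<^sub>w * log 2 (real n)" "real w \<ge> 14 + 4 / c\<^sub>w"
    and r: "r = log 2 (real n) / log 2 (real w * real (update_time n b D))" "\<kappa> * r > 32"
  shows "\<kappa> ^ 2 / 4096 * r ^ 2 \<le> query_time n b D"
proof -
  define u where "u = update_time n b D"
  define s where "s = w * u"
  define \<gamma> B where "\<gamma> = s ^ 2" and "B = \<gamma> ^ 4"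
  define lg where "lg = log 2 (real s)"
  define E where "E = nat \<lfloor>\<kappa> * r\<rfloor>"
  define \<tau> where "\<tau> = E div 16"
  have ln0: "log 2 (real n) \<ge> 0" using n by simp
  have "4 / c\<^sub>w \<ge> 0" using pos by simp
  then have w14: "w \<ge> 14" using w(2) by linarith
  have r_eq: "r = log 2 (real n) / lg" by (simp add: r(1) lg_def s_def u_def)
  have "r > 0" using r(2) \<kappa>(1) by (smt (verit) mult_nonneg_nonpos)
  then have "lg > 0" using ln0 unfolding r_eq by (simp add: zero_less_divide_iff)
  \<comment> \<open>In HOL the logarithm of 0 is 0 and so is division by 0. Update time 0 would thus
    give r = 0.\<close>
  moreover have "lg = 0" if "s = 0" using that by (simp add: lg_def log_def)
  ultimately have "s \<noteq> 0" by auto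
  then have u1: "u \<ge> 1" by (auto simp: s_def)
  have ws: "w \<le> s" "u \<le> s" using u1 w14 by (auto simp: s_def)
  have s14: "s \<ge> 14" using ws w14 by simp
  have l1: "lg \<ge> 1" unfolding lg_def using s14 by (simp add: le_log_iff)
  have rl: "r * lg = log 2 (real n)" using \<open>lg > 0\<close> by (simp add: r_eq)
  have E: "real E \<le> \<kappa> * r" "\<kappa> * r < real E + 1"
    using r(2) unfolding E_def by linarith+
  then have E32: "E \<ge> 32" using r(2) by linarith
  have B_eq: "B = s ^ 8" by (simp add: B_def \<gamma>_def flip: power_mult)
  have B1: "B \<ge> 1" using s14 by (simp add: B_eq)
  have logB: "log 2 (real B) = 8 * lg" using s14 by (simp add: B_eq lg_def log_nat_power)
  \<comment> \<open>The doubled exponent absorbs the factor E + 1 in \<open>room\<close>.\<close>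
  have "B ^ (2 * Suc E) \<le> n"
  proof -
    have "log 2 (real (B ^ (2 * Suc E))) = real (2 * Suc E) * (8 * lg)"
      using B1 by (simp add: log_nat_power logB del: power_Suc mult_Suc_right)
    also have "\<dots> = 16 * (real E + 1) * lg" by (simp add: algebra_simps)
    also have "\<dots> \<le> 16 * (2 * (\<kappa> * r)) * lg" using E r(2) l1 by (intro mult_right_mono mult_left_mono) auto
    also have "\<dots> = 32 * \<kappa> * log 2 (real n)" by (simp flip: rl)
    also have "\<dots> \<le> 1 * log 2 (real n)" using \<kappa>(2) ln0 by (intro mult_right_mono) auto
    finally have "real (B ^ (2 * Suc E)) \<le> real n"
      using B1 n by (subst (asm) mult_1_left, subst (asm) log_le_cancel_iff) auto
    then show ?thesis by (simp only: of_nat_le_iff)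
  qed
  moreover have "Suc E \<le> B ^ Suc E"
  proof -
    have "Suc E \<le> 2 ^ Suc E" by (rule less_imp_le[OF less_exp])
    also have "\<dots> \<le> B ^ Suc E" using s14 self_le_power[of s 8] by (intro power_mono) (auto simp: B_eq)
    finally show ?thesis .
  qed
  then have "Suc E * B ^ Suc E \<le> B ^ (2 * Suc E)"
    by (simp only: mult_2 power_add mult_right_mono)
  ultimately have room: "Suc E * B ^ Suc E \<le> n" by linarith
  have small: "B ^ (4 * E) \<le> 2 ^ b"
  proof (rule power_le_two_power[OF B1])
    have "real (4 * E) * log 2 (real B) = 32 * real E * lg" by (simp add: logB)
    also have "\<dots> \<le> 32 * (\<kappa> * r) * lg" using E(1) l1 by (intro mult_right_mono mult_left_mono) auto
    also have "\<dots> = 32 * \<kappa> * log 2 (real n)" by (simp flip: rl)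
    also have "\<dots> \<le> c\<^sub>1 * log 2 (real n)" using \<kappa>(3) ln0 by (intro mult_right_mono) auto
    also have "\<dots> \<le> real b" by (rule b(2))
    finally show "real (4 * E) * log 2 (real B) \<le> real b" .
  qed
  \<comment> \<open>The assumption that w is at least of order log n enters through \<tau> \<le> r
    \<le> log n.\<close>
  have \<tau>_le: "real \<tau> \<le> real w / c\<^sub>w"
  proof -
    have "real \<tau> \<le> real E" by (simp add: \<tau>_def)
    also have "\<dots> \<le> \<kappa> * r" by (rule E(1))
    also have "\<dots> \<le> 1 * r" using \<kappa> \<open>r > 0\<close> by (intro mult_right_mono) auto
    also have "\<dots> \<le> r * lg" using l1 \<open>r > 0\<close> by simp
    also have "\<dots> \<le> real w / c\<^sub>w" unfolding rl using w(1) pos by (simp add: field_simps)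
    finally show ?thesis .
  qed
  have budget: "6 + 4 * (w * (\<tau> + 2 * u)) \<le> b * s ^ 3"
  proof -
    have "real (6 + 4 * (w * (\<tau> + 2 * u))) = 6 + 4 * (real w * real \<tau>) + 8 * real s"
      by (simp add: s_def algebra_simps)
    also have "\<dots> \<le> 6 * real s ^ 2 + (4 / c\<^sub>w) * real s ^ 2 + 8 * real s ^ 2"
    proof (intro add_mono)
      have "real w * real \<tau> \<le> real w * (real w / c\<^sub>w)" using \<tau>_le by (intro mult_left_mono) auto
      also have "\<dots> \<le> real s * (real s / c\<^sub>w)" using ws pos by (intro mult_mono divide_right_mono) auto
      finally show "4 * (real w * real \<tau>) \<le> (4 / c\<^sub>w) * real s ^ 2" by (simp add: power2_eq_square)
    qed (use s14 in \<open>auto simp: self_le_power\<close>)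
    also have "\<dots> = (14 + 4 / c\<^sub>w) * real s ^ 2" by (simp add: algebra_simps)
    also have "\<dots> \<le> real s * real s ^ 2"
      using w(2) ws by (intro mult_right_mono) auto
    also have "\<dots> = real (s ^ 3)" by (simp add: power3_eq_cube power2_eq_square)
    also have "\<dots> \<le> real (b * s ^ 3)" using b(1) by (intro of_nat_mono) simp
    finally show ?thesis by (simp only: of_nat_le_iff)
  qed
  have "(\<Sum>e<Suc E. B ^ Suc e) \<le> n"
  proof -
    have "B \<ge> 2" using s14 self_le_power[of s 8] by (simp add: B_eq)
    then have "(\<Sum>e<E. B ^ Suc e) \<le> 2 * B ^ E" by (rule sum_powers_le)
    also have "\<dots> \<le> B ^ Suc E" using \<open>B \<ge> 2\<close> by simp
    finally have "(\<Sum>e<Suc E. B ^ Suc e) \<le> 2 * B ^ Suc E" by simp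
    also have "\<dots> \<le> Suc E * B ^ Suc E" using E32 by (intro mult_right_mono) auto
    finally show ?thesis using room by simp
  qed
  from filler_exists[OF this, of b] obtain F where F: "set F \<subseteq> grid n \<times> {0..<2 ^ b :: nat}" "distinct (map fst F)"
    "\<forall>e\<le>E. \<forall>z\<in>words B (Suc e). pt n B E e z \<notin> fst ` set F"
    "length F + (\<Sum>e<Suc E. B ^ Suc e) = n"
    by blast
  interpret hard_instance n w b B \<gamma> \<tau> "s ^ 3" E D F
  proof
    show "54 < \<gamma>" using power_mono[OF s14, of 2] by (simp add: \<gamma>_def)
    show "update_time n b D \<le> B"
      using ws(2) self_le_power[of s 8] s14 by (simp add: B_eq u_def)
    show "4 * s ^ 3 + 2 \<le> \<gamma>\<^sup>2"
    proof -
      have "4 * s ^ 3 + 2 \<le> 5 * s ^ 3" using s14 self_le_power[of s 3] by simp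
      also have "\<dots> \<le> s * s ^ 3" using s14 by (intro mult_right_mono) auto
      finally show ?thesis by (simp add: \<gamma>_def flip: power_mult power_Suc)
    qed
  qed (use ds B_def u1 E32 small budget room F in \<open>auto simp: \<tau>_def u_def simp del: power_Suc\<close>)
  \<comment> \<open>Rounding gives E \<ge> \<kappa> r / 2 and \<tau> \<ge> E / 32. With the 1 / 32
    of \<open>query_time_ge\<close> the total loss is 4 * 32 * 32 = 4096.\<close>
  have "\<kappa> * r / 2 \<le> real E" using E r(2) by linarith
  then have "(\<kappa> * r / 2) ^ 2 \<le> real E ^ 2" using \<kappa> \<open>r > 0\<close> by (intro power_mono) auto
  then have "\<kappa> ^ 2 / 4096 * r ^ 2 \<le> real E * (real E / 32) / 32"
    by (simp add: power_mult_distrib power_divide power2_eq_square[of "real E"])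
  also have "\<dots> \<le> real E * real \<tau> / 32"
  proof -
    have "E \<le> 32 * \<tau>" unfolding \<tau>_def using E32 by linarith
    then have "real E / 32 \<le> real \<tau>" by simp
    then show ?thesis by (intro divide_right_mono mult_left_mono) auto
  qed
  also have "\<dots> \<le> query_time n b D" by (rule query_time_ge)
  finally show ?thesis .
qed

theorem theorem1:
  fixes c\<^sub>w c\<^sub>1 c\<^sub>2 :: real
  assumes "c\<^sub>w > 0" and "c\<^sub>1 > 0" and "c\<^sub>2 > 0"
  shows "\<exists>C > 0. \<exists>N. \<forall>n \<ge> N. \<forall>(w :: nat) (b :: nat) D.
           real w \<ge> c\<^sub>w * log 2 (real n) \<longrightarrow>
           c\<^sub>1 * log 2 (real n) \<le> real b \<longrightarrow> real b \<le> c\<^sub>2 * log 2 (real n) \<longrightarrow>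
           is_range_ds w n b D \<longrightarrow>
           query_time n b D \<ge>
             C * (log 2 (real n) / log 2 (real w * real (update_time n b D))) ^ 2"
proof -
  define \<kappa> where "\<kappa> = min (1 / 32) (c\<^sub>1 / 32)"
  have \<kappa>: "\<kappa> > 0" "\<kappa> \<le> 1 / 32" "\<kappa> \<le> c\<^sub>1 / 32" using assms by (auto simp: \<kappa>_def)
  define C where "C = \<kappa> ^ 2 / 4096"
  \<comment> \<open>Beyond this threshold for log n the assumptions on b and w yield b \<ge> 1 and
    \<open>w \<ge> 14 + 4 / c\<^sub>w\<close>.\<close>
  define L where "L = max (1 / c\<^sub>1) ((14 + 4 / c\<^sub>w) / c\<^sub>w)"
  define N where "N = max 1 (nat \<lceil>2 powr L\<rceil>)"
  have main: "C * r ^ 2 \<le> query_time n b D"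
    if n: "n \<ge> N" and w: "real w \<ge> c\<^sub>w * log 2 (real n)" and b: "c\<^sub>1 * log 2 (real n) \<le> real b"
      and ds: "is_range_ds w n b D"
      and r: "r = log 2 (real n) / log 2 (real w * real (update_time n b D))" for n w b D r
  proof -
    have n1: "n \<ge> 1" using n by (simp add: N_def)
    have "2 powr L \<le> real n" using n by (simp add: N_def ceiling_le_iff nat_le_iff)
    then have L: "L \<le> log 2 (real n)" using n1 by (subst le_log_iff) auto
    have "1 / c\<^sub>1 \<le> log 2 (real n)" "(14 + 4 / c\<^sub>w) / c\<^sub>w \<le> log 2 (real n)"
      using L by (auto simp: L_def)
    then have "1 \<le> c\<^sub>1 * log 2 (real n)" "14 + 4 / c\<^sub>w \<le> c\<^sub>w * log 2 (real n)"
      using assms by (simp_all add: field_simps)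
    then have b1: "b \<ge> 1" and w14: "real w \<ge> 14 + 4 / c\<^sub>w" using b w by linarith+
    show ?thesis
    proof (cases "\<kappa> * r > 32")
      case True
      then show ?thesis unfolding C_def
        by (intro query_time_ge_square[OF assms(1) \<kappa> ds n1 b1 b w w14 r])
    next
      \<comment> \<open>For \<kappa> r \<le> 32 the claimed bound is at most 32^2 / 4096 \<le> 1,
        and every query probes a cell. To square the inequality r must be nonnegative, also for
        update time 0, where the logarithm is 0 by convention.\<close>
      case False
      have "log 2 (real w * real (update_time n b D)) \<ge> 0"
      proof (cases "w * update_time n b D = 0")
        case False
        then have "1 \<le> real (w * update_time n b D)" by linarith
        then show ?thesis by simp
      qed (auto simp: log_def)
      then have "r \<ge> 0" unfolding r using n1 by simp
      with False \<kappa>(1) have "(\<kappa> * r) ^ 2 \<le> 32 ^ 2" by (intro power_mono) auto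
      then have "C * r ^ 2 \<le> 1" by (simp add: C_def power_mult_distrib)
      then show ?thesis using query_time_ge_1[OF ds n1 b1] by simp
    qed
  qed
  have "C > 0" using \<kappa>(1) by (simp add: C_def)
  then show ?thesis using main by blast
qed

end
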